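(* Let $\mathscr{A}$ be a locally finitely presentable category. For any two objects $a,b\in\mathscr{A}$ of finite $\mathscr{A}_{\mathrm{fp}}$-type, \[ a\cong b \iff \hom_{\mathscr{A}}(c,a)\cong\hom_{\mathscr{A}}(c,b)\ \text{ (a bijection of sets) for all } c\in\mathscr{A}_{\mathrm{fg}}. \]
   Context: An object $a$ of $\mathscr{A}$ is finitely presentable (respectively, finitely generated) if $\hom_{\mathscr{A}}(a,-)\colon\mathscr{A}\to\mathbf{Set}$ preserves directed colimits (respectively, directed colimits of monomorphisms). $\mathscr{A}$ is locally finitely presentable if it is cocomplete, every object is a directed colimit of finitely presentable objects, and there is, up to isomorphism, only a set of finitely presentable objects. $\mathscr{A}_{\mathrm{fp}}$ and $\mathscr{A}_{\mathrm{fg}}$ denote the full subcategories of $\mathscr{A}$ on the finitely presentable and on the finitely generated objects, respectively. An object $a\in\mathscr{A}$ is of finite $\mathscr{A}_{\mathrm{fp}}$-type if $\hom_{\mathscr{A}}(c,a)$ is a finite set for every $c\in\mathscr{A}_{\mathrm{fp}}$. *)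

theory Defs
  imports "HOL-Library.FuncSet"
begin

unbundle cardinal_syntax

section \<open>Size\<close>

text \<open>
  The type \<open>'u\<close> plays the role of a universe: a set (of elements of any type) counts as small,
  i.e. as a set rather than a proper class, if it has fewer elements than \<open>'u\<close>. For a Grothendieck
  universe \<open>|UNIV :: 'u set|\<close> is an inaccessible cardinal. Of inaccessibility we only ask for
  regularity and uncountability: countable sets are small, and small unions of small sets are
  small. That small sets have small power sets is not required, so all inaccessible cardinals
  are covered.
\<close>

definition small :: "'u itself \<Rightarrow> 'x set \<Rightarrow> bool" where
  "small U X \<longleftrightarrow> |X| <o |UNIV :: 'u set|"

definition universe :: "'u itself \<Rightarrow> bool" where
  "universe U \<longleftrightarrow> small U (UNIV :: nat set) \<and> regularCard |UNIV :: 'u set|"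


section \<open>Categories and functors\<close>

text \<open>
  Hom-sets of different pairs of objects may overlap, so that composition takes the three objects
  as arguments: for \<open>f \<in> hom C x y\<close> and \<open>g \<in> hom C y z\<close>, the composite of \<open>g\<close> after \<open>f\<close> is
  \<open>cmp C x y z g f\<close>.
\<close>

record ('o, 'm) cat =
  obj :: "'o set"
  hom :: "'o \<Rightarrow> 'o \<Rightarrow> 'm set"
  idn :: "'o \<Rightarrow> 'm"
  cmp :: "'o \<Rightarrow> 'o \<Rightarrow> 'o \<Rightarrow> 'm \<Rightarrow> 'm \<Rightarrow> 'm"

definition category :: "('o, 'm) cat \<Rightarrow> bool" where
  "category C \<longleftrightarrow>
     (\<forall>x\<in>obj C. idn C x \<in> hom C x x) \<and>
     (\<forall>x\<in>obj C. \<forall>y\<in>obj C. \<forall>z\<in>obj C. \<forall>f\<in>hom C x y. \<forall>g\<in>hom C y z.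
        cmp C x y z g f \<in> hom C x z) \<and>
     (\<forall>x\<in>obj C. \<forall>y\<in>obj C. \<forall>f\<in>hom C x y.
        cmp C x x y f (idn C x) = f \<and> cmp C x y y (idn C y) f = f) \<and>
     (\<forall>w\<in>obj C. \<forall>x\<in>obj C. \<forall>y\<in>obj C. \<forall>z\<in>obj C.
        \<forall>f\<in>hom C w x. \<forall>g\<in>hom C x y. \<forall>h\<in>hom C y z.
        cmp C w y z h (cmp C w x y g f) = cmp C w x z (cmp C x y z h g) f)"

text \<open>
  A locally small category is represented with its hom-sets consisting of elements of the
  universe \<open>'u\<close>; its objects form a class of arbitrary type \<open>'o\<close>.
\<close>

definition locally_small :: "('o, 'u) cat \<Rightarrow> bool" where
  "locally_small C \<longleftrightarrow> (\<forall>x\<in>obj C. \<forall>y\<in>obj C. small TYPE('u) (hom C x y))"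

definition small_category :: "('u, 'u) cat \<Rightarrow> bool" where
  "small_category J \<longleftrightarrow> category J \<and> small TYPE('u) (obj J) \<and> locally_small J"

definition monic :: "('o, 'm) cat \<Rightarrow> 'o \<Rightarrow> 'o \<Rightarrow> 'm \<Rightarrow> bool" where
  "monic C x y f \<longleftrightarrow> f \<in> hom C x y \<and>
     (\<forall>w\<in>obj C. \<forall>g\<in>hom C w x. \<forall>h\<in>hom C w x. cmp C w x y f g = cmp C w x y f h \<longrightarrow> g = h)"

definition isomorphic :: "('o, 'm) cat \<Rightarrow> 'o \<Rightarrow> 'o \<Rightarrow> bool" where
  "isomorphic C x y \<longleftrightarrow>
     (\<exists>f\<in>hom C x y. \<exists>g\<in>hom C y x. cmp C x y x g f = idn C x \<and> cmp C y x y f g = idn C y)"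

record ('o1, 'm1, 'o2, 'm2) func =
  omap :: "'o1 \<Rightarrow> 'o2"
  amap :: "'o1 \<Rightarrow> 'o1 \<Rightarrow> 'm1 \<Rightarrow> 'm2"

definition is_functor ::
  "('o1, 'm1) cat \<Rightarrow> ('o2, 'm2) cat \<Rightarrow> ('o1, 'm1, 'o2, 'm2) func \<Rightarrow> bool" where
  "is_functor C D F \<longleftrightarrow>
     (\<forall>x\<in>obj C. omap F x \<in> obj D) \<and>
     (\<forall>x\<in>obj C. \<forall>y\<in>obj C. \<forall>f\<in>hom C x y. amap F x y f \<in> hom D (omap F x) (omap F y)) \<and>
     (\<forall>x\<in>obj C. amap F x x (idn C x) = idn D (omap F x)) \<and>
     (\<forall>x\<in>obj C. \<forall>y\<in>obj C. \<forall>z\<in>obj C. \<forall>f\<in>hom C x y. \<forall>g\<in>hom C y z.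
        amap F x z (cmp C x y z g f) =
          cmp D (omap F x) (omap F y) (omap F z) (amap F y z g) (amap F x y f))"

definition comp_func ::
  "('o2, 'm2, 'o3, 'm3) func \<Rightarrow> ('o1, 'm1, 'o2, 'm2) func \<Rightarrow> ('o1, 'm1, 'o3, 'm3) func" where
  "comp_func G F =
     \<lparr> omap = (\<lambda>x. omap G (omap F x)),
       amap = (\<lambda>x y f. amap G (omap F x) (omap F y) (amap F x y f)) \<rparr>"

definition set_cat :: "('u set, 'u \<Rightarrow> 'u) cat" where
  "set_cat =
     \<lparr> obj = {X. small TYPE('u) X},
       hom = (\<lambda>X Y. X \<rightarrow>\<^sub>E Y),
       idn = (\<lambda>X. \<lambda>x\<in>X. x),
       cmp = (\<lambda>X Y Z g f. compose X g f) \<rparr>"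

definition hom_func :: "('o, 'u) cat \<Rightarrow> 'o \<Rightarrow> ('o, 'u, 'u set, 'u \<Rightarrow> 'u) func" where
  "hom_func C a =
     \<lparr> omap = (\<lambda>x. hom C a x),
       amap = (\<lambda>x y f. \<lambda>g\<in>hom C a x. cmp C a x y f g) \<rparr>"


section \<open>Colimits\<close>

definition is_cocone ::
  "('j, 'n) cat \<Rightarrow> ('o, 'm) cat \<Rightarrow> ('j, 'n, 'o, 'm) func \<Rightarrow> 'o \<Rightarrow> ('j \<Rightarrow> 'm) \<Rightarrow> bool" where
  "is_cocone J C F z t \<longleftrightarrow> z \<in> obj C \<and>
     (\<forall>i\<in>obj J. t i \<in> hom C (omap F i) z) \<and>
     (\<forall>i\<in>obj J. \<forall>j\<in>obj J. \<forall>u\<in>hom J i j.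
        cmp C (omap F i) (omap F j) z (t j) (amap F i j u) = t i)"

definition is_colimit ::
  "('j, 'n) cat \<Rightarrow> ('o, 'm) cat \<Rightarrow> ('j, 'n, 'o, 'm) func \<Rightarrow> 'o \<Rightarrow> ('j \<Rightarrow> 'm) \<Rightarrow> bool" where
  "is_colimit J C F z t \<longleftrightarrow> is_cocone J C F z t \<and>
     (\<forall>y s. is_cocone J C F y s \<longrightarrow>
        (\<exists>!h. h \<in> hom C z y \<and> (\<forall>i\<in>obj J. cmp C (omap F i) z y h (t i) = s i)))"

text \<open>
  Every small category is isomorphic to one whose objects and arrows are elements of \<open>'u\<close>, so
  such index categories suffice; likewise for directed posets below.
\<close>

definition cocomplete :: "('o, 'u) cat \<Rightarrow> bool" where
  "cocomplete C \<longleftrightarrow>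
     (\<forall>(J :: ('u, 'u) cat) F. small_category J \<longrightarrow> is_functor J C F \<longrightarrow>
        (\<exists>z t. is_colimit J C F z t))"

definition preserves_colimits_of ::
  "('j, 'n) cat \<Rightarrow> ('o, 'm) cat \<Rightarrow> ('p, 'k) cat \<Rightarrow> ('o, 'm, 'p, 'k) func \<Rightarrow>
   ('j, 'n, 'o, 'm) func \<Rightarrow> bool" where
  "preserves_colimits_of J C D G F \<longleftrightarrow>
     (\<forall>z t. is_colimit J C F z t \<longrightarrow>
        is_colimit J D (comp_func G F) (omap G z) (\<lambda>i. amap G (omap F i) z (t i)))"

definition poset_cat :: "'i set \<Rightarrow> 'i rel \<Rightarrow> ('i, unit) cat" where
  "poset_cat I r =
     \<lparr> obj = I,
       hom = (\<lambda>i j. {u. (i, j) \<in> r}),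
       idn = (\<lambda>i. ()),
       cmp = (\<lambda>i j k g f. ()) \<rparr>"

definition directed_poset :: "'i set \<Rightarrow> 'i rel \<Rightarrow> bool" where
  "directed_poset I r \<longleftrightarrow> partial_order_on I r \<and> I \<noteq> {} \<and>
     (\<forall>i\<in>I. \<forall>j\<in>I. \<exists>k\<in>I. (i, k) \<in> r \<and> (j, k) \<in> r)"

definition directed_diagram ::
  "'u set \<Rightarrow> 'u rel \<Rightarrow> ('o, 'u) cat \<Rightarrow> ('u, unit, 'o, 'u) func \<Rightarrow> bool" where
  "directed_diagram I r C F \<longleftrightarrow>
     small TYPE('u) I \<and> directed_poset I r \<and> is_functor (poset_cat I r) C F"

definition preserves_directed_colimits ::
  "('o, 'u) cat \<Rightarrow> ('p, 'k) cat \<Rightarrow> ('o, 'u, 'p, 'k) func \<Rightarrow> bool" where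
  "preserves_directed_colimits C D G \<longleftrightarrow>
     (\<forall>I r F. directed_diagram I r C F \<longrightarrow> preserves_colimits_of (poset_cat I r) C D G F)"

definition preserves_directed_colimits_of_monos ::
  "('o, 'u) cat \<Rightarrow> ('p, 'k) cat \<Rightarrow> ('o, 'u, 'p, 'k) func \<Rightarrow> bool" where
  "preserves_directed_colimits_of_monos C D G \<longleftrightarrow>
     (\<forall>I r F. directed_diagram I r C F \<longrightarrow>
        (\<forall>(i, j)\<in>r. monic C (omap F i) (omap F j) (amap F i j ())) \<longrightarrow>
        preserves_colimits_of (poset_cat I r) C D G F)"


section \<open>Locally finitely presentable categories\<close>

definition fp_objects :: "('o, 'u) cat \<Rightarrow> 'o set" where
  "fp_objects C = {a \<in> obj C. preserves_directed_colimits C set_cat (hom_func C a)}"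

definition fg_objects :: "('o, 'u) cat \<Rightarrow> 'o set" where
  "fg_objects C = {a \<in> obj C. preserves_directed_colimits_of_monos C set_cat (hom_func C a)}"

definition locally_finitely_presentable :: "('o, 'u) cat \<Rightarrow> bool" where
  "locally_finitely_presentable C \<longleftrightarrow>
     category C \<and> locally_small C \<and> cocomplete C \<and>
     (\<forall>a\<in>obj C. \<exists>I r F t. directed_diagram I r C F \<and> omap F ` I \<subseteq> fp_objects C \<and>
        is_colimit (poset_cat I r) C F a t) \<and>
     (\<exists>S\<subseteq>fp_objects C. small TYPE('u) S \<and> (\<forall>a\<in>fp_objects C. \<exists>s\<in>S. isomorphic C a s))"

definition finite_fp_type :: "('o, 'u) cat \<Rightarrow> 'o \<Rightarrow> bool" where
  "finite_fp_type C a \<longleftrightarrow> (\<forall>c\<in>fp_objects C. finite (hom C c a))"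

end

theory Submission
  imports Defs "HOL-Analysis.Function_Topology"
begin

text \<open>
  Images (strong epi, mono) of arrows \<open>p \<rightarrow> a\<close> with \<open>p\<close> finitely presentable are finitely generated.
  Following Lovasz, split \<open>hom(c,a)\<close> according to the strong epi part of an arrow: for strong quotients
  \<open>c\<close> of finitely presentable objects all numbers are finite, and by induction on
  \<open>|hom(c,a)| + |hom(c,b)|\<close> equality of the hom-counts gives equally many monos \<open>c \<rightarrow> a\<close> and \<open>c \<rightarrow> b\<close>.
  Writing \<open>a\<close> as a directed colimit of finitely presentable objects \<open>p_i\<close> with images \<open>q_i\<close> in \<open>a\<close>,
  the monos \<open>q_i \<rightarrow> b\<close> form an inverse system of finite nonempty sets. A point of its limit is an arrow
  \<open>h: a \<rightarrow> b\<close> that is injective on all \<open>hom(p,-)\<close>, \<open>p\<close> finitely presentable. There is such an arrow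
  \<open>b \<rightarrow> a\<close> as well, so finiteness makes \<open>h\<close> bijective on these hom-sets, hence invertible.
\<close>

text \<open>The bijections between the sets \<open>hom A c a\<close> and \<open>hom A c b\<close>
  are unrelated for different \<open>c\<close>, so no arrow between \<open>a\<close> and
  \<open>b\<close> is given and one must be produced from counts alone. Counting yields a mono into
  \<open>b\<close> from each image \<open>q_i\<close> separately, with no compatibility between the
  choices; finiteness turns this into a compactness problem. The counting itself passes from
  \<open>c\<close> to its strong quotients, and finitely presentable objects need not be closed
  under these: this is where finitely generated test objects enter. Strong epis are used instead of
  all epis because the diagonal property makes the image factorization unique up to isomorphism, so
  that arrows fall into well-defined classes.\<close>

lemma small_mono: "X \<subseteq> Y \<Longrightarrow> small U Y \<Longrightarrow> small U X"
  unfolding small_def using card_of_mono1 ordLeq_ordLess_trans by blast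

lemma small_image: "small U X \<Longrightarrow> small U (f ` X)"
  unfolding small_def using card_of_image ordLeq_ordLess_trans by blast

lemma small_embedding:
  assumes "small (U :: 'u itself) (X :: 'x set)"
  obtains \<phi> :: "'x \<Rightarrow> 'u" where "inj_on \<phi> X"
  using assms card_of_ordLeq[of X "UNIV :: 'u set"] ordLess_imp_ordLeq
  unfolding small_def by blast

context
  fixes U :: "'u itself"
  assumes U: "universe U"
begin

lemma universe_infinite: "infinite (UNIV :: 'u set)"
  using U unfolding universe_def small_def
  by (meson card_of_ordLeq_infinite infinite_UNIV_nat ordLess_imp_ordLeq)

lemma small_finite: "finite X \<Longrightarrow> small U X"
  unfolding small_def using finite_ordLess_infinite[OF card_of_Well_order card_of_Well_order] universe_infinite
  by (simp add: Field_card_of)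

text \<open>Regularity of the cardinal of the universe is what closes small sets under small
  unions.\<close>

lemma small_UN:
  assumes "small U I" "\<And>i. i \<in> I \<Longrightarrow> small U (X i)"
  shows "small U (\<Union>i\<in>I. X i)"
proof -
  have "Cinfinite |UNIV :: 'u set|"
    using universe_infinite by (simp add: cinfinite_def Field_card_of card_of_card_order_on)
  then show ?thesis
    using assms card_of_UNION_ordLess_infinite_Field_regularCard U
    unfolding small_def universe_def by blast
qed

lemma small_Un: "small U X \<Longrightarrow> small U Y \<Longrightarrow> small U (X \<union> Y)"
  using small_UN[of "{X, Y}" "\<lambda>Z. Z"] by (fastforce simp: small_finite)

lemma small_Sigma:
  assumes "small U I" "\<And>i. i \<in> I \<Longrightarrow> small U (X i)"
  shows "small U (Sigma I X)"
proof -
  have "Sigma I X = (\<Union>i\<in>I. Pair i ` X i)" by auto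
  then show ?thesis using assms using small_UN[of I "\<lambda>i. Pair i ` X i"] by (simp add: small_image)
qed

text \<open>Objects of \<open>set_cat\<close> are sets of elements of \<open>'u\<close>, so the two
  truth values used to test colimits of sets have to be found in \<open>'u\<close>.\<close>

lemma universe_two_elements: "\<exists>x y :: 'u. x \<noteq> y"
  using universe_infinite by (metis (full_types) finite.simps UNIV_eq_I insertI1)

end

text \<open>Tychonoff: the product of the finite discrete sets \<open>N i\<close> is compact, and
  the compatible families are the intersection of a down-directed system of nonempty closed
  sets.\<close>

lemma finite_inverse_limit:
  fixes \<rho> :: "'i \<Rightarrow> 'i \<Rightarrow> 'x \<Rightarrow> 'x"
  assumes dir: "directed_poset I r"
    and fin: "\<And>i. i \<in> I \<Longrightarrow> finite (N i)" and ne: "\<And>i. i \<in> I \<Longrightarrow> N i \<noteq> {}"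
    and map: "\<And>i j y. (i, j) \<in> r \<Longrightarrow> y \<in> N j \<Longrightarrow> \<rho> i j y \<in> N i"
    and comp: "\<And>i j k y. (i, j) \<in> r \<Longrightarrow> (j, k) \<in> r \<Longrightarrow> y \<in> N k \<Longrightarrow> \<rho> i k y = \<rho> i j (\<rho> j k y)"
  shows "\<exists>x\<in>Pi\<^sub>E I N. \<forall>(i, j)\<in>r. x i = \<rho> i j (x j)"
proof -
  have sub: "r \<subseteq> I \<times> I" and refl: "\<And>i. i \<in> I \<Longrightarrow> (i, i) \<in> r" and tr: "trans r"
    using dir unfolding directed_poset_def partial_order_on_def preorder_on_def refl_on_def by auto
  define T where "T = product_topology (\<lambda>i. discrete_topology (N i)) I"
  have top: "topspace T = Pi\<^sub>E I N" by (simp add: T_def)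
  have cpt: "compact_space T"
    unfolding T_def using fin by (simp add: compact_space_product_topology compact_space_discrete_topology)
  \<comment> \<open>Only compatibility between \<open>k\<close> and the indices below it is
    required. This makes \<open>K\<close> decreasing in \<open>k\<close>, and each
    \<open>K k\<close> can be shown nonempty from a single element of \<open>N k\<close>.\<close>
  define K where "K = (\<lambda>k. {x \<in> Pi\<^sub>E I N. \<forall>i. (i, k) \<in> r \<longrightarrow> x i = \<rho> i k (x k)})"
  have cyl: "closedin T {x \<in> Pi\<^sub>E I N. x i = w}" if "i \<in> I" for i w
  proof -
    have "closedin T {x \<in> topspace T. x i \<in> {w} \<inter> N i}"
      by (rule closedin_continuous_map_preimage[where Y="discrete_topology (N i)"])
        (use that in \<open>auto simp: T_def intro: continuous_map_product_projection\<close>)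
    moreover have "{x \<in> topspace T. x i \<in> {w} \<inter> N i} = {x \<in> Pi\<^sub>E I N. x i = w}"
      using that by (auto simp: top)
    ultimately show ?thesis by simp
  qed
  have cl: "closedin T (K k)" if k: "k \<in> I" for k
  proof -
    \<comment> \<open>Once the value \<open>w\<close> at \<open>k\<close> is fixed, the condition at
      \<open>i\<close> is a cylinder; the union over \<open>w\<close> is finite. The index set
      contains \<open>k\<close> itself, so the intersection is not over an empty family.\<close>
    have "K k = \<Inter> ((\<lambda>i. \<Union>w\<in>N k. {x \<in> Pi\<^sub>E I N. x k = w} \<inter> {x \<in> Pi\<^sub>E I N. x i = \<rho> i k w}) ` {i. (i, k) \<in> r})"
      using refl[OF k] k unfolding K_def by (auto dest: PiE_mem)
    also have "closedin T \<dots>"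
      using refl[OF k] sub by (intro closedin_INT closedin_Union closedin_Int) (auto intro!: cyl fin k closedin_Int)
    finally show ?thesis .
  qed
  have Kmono: "K k \<subseteq> K j" if jk: "(j, k) \<in> r" for j k
  proof
    fix x assume x: "x \<in> K k"
    show "x \<in> K j"
      unfolding K_def
    proof (intro CollectI conjI allI impI)
      show "x \<in> Pi\<^sub>E I N" using x unfolding K_def by blast
      fix i assume ij: "(i, j) \<in> r"
      have "(i, k) \<in> r" using ij jk tr by (meson transD)
      moreover have "x k \<in> N k" using x jk sub unfolding K_def by (auto dest: PiE_mem)
      ultimately show "x i = \<rho> i j (x j)"
        using comp[OF ij jk, of "x k"] x jk unfolding K_def by simp
    qed
  qed
  have Kne: "K k \<noteq> {}" if k: "k \<in> I" for k
  proof -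
    obtain y where y: "y \<in> N k" using ne k by blast
    \<comment> \<open>Below \<open>k\<close> the family is the restriction of \<open>y\<close>,
      elsewhere it is arbitrary. Its value at \<open>k\<close> is \<open>\<rho> k k y\<close>, and
      the composition law for \<open>(i, k)\<close> and \<open>(k, k)\<close> gives
      compatibility.\<close>
    define x where "x = (\<lambda>i\<in>I. if (i, k) \<in> r then \<rho> i k y else (SOME z. z \<in> N i))"
    have "x \<in> Pi\<^sub>E I N"
      using ne map y unfolding x_def by (auto simp: some_in_eq)
    moreover have "x i = \<rho> i k (x k)" if "(i, k) \<in> r" for i
      using that sub refl[OF k] comp[OF that refl[OF k] y] k unfolding x_def by auto
    ultimately show ?thesis unfolding K_def by blast
  qed
  have "\<Inter> (K ` I) \<noteq> {}"
  proof -
    have "\<exists>k\<in>I. K k \<subseteq> \<Inter> (K ` J)" if "finite J" "J \<subseteq> I" for J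
      using that
    proof (induction J rule: finite_induct)
      case empty
      then show ?case using dir unfolding directed_poset_def by blast
    next
      case (insert j J)
      then obtain k where k: "k \<in> I" "K k \<subseteq> \<Inter> (K ` J)" by blast
      moreover obtain l where "l \<in> I" "(j, l) \<in> r" "(k, l) \<in> r"
        using dir insert.prems k(1) unfolding directed_poset_def by blast
      ultimately show ?case using Kmono[of j l] Kmono[of k l] by (intro bexI[of _ l]) auto
    qed
    then have "\<Inter>F \<noteq> {}" if "finite F" "F \<subseteq> K ` I" for F
      using that Kne finite_subset_image[OF that] by (metis subset_empty)
    then show ?thesis
      using cpt[unfolded compact_space_fip, rule_format, of "K ` I"] cl by blast
  qed
  then obtain x where "\<forall>k\<in>I. x \<in> K k" by blast
  then show ?thesis
    using sub dir unfolding directed_poset_def K_def by blast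
qed

section \<open>Elementary rules for posets, sets, functors and cocones\<close>

lemma poset_cat_simps [simp]:
  "obj (poset_cat I r) = I" "u \<in> hom (poset_cat I r) i j \<longleftrightarrow> (i, j) \<in> r"
  "idn (poset_cat I r) i = ()" "cmp (poset_cat I r) i j k g f = ()"
  by (simp_all add: poset_cat_def)

lemma set_cat_simps [simp]:
  "obj (set_cat :: ('u set, 'u \<Rightarrow> 'u) cat) = {X. small TYPE('u) X}"
  "hom set_cat X Y = X \<rightarrow>\<^sub>E Y"
  "idn set_cat X = (\<lambda>x\<in>X. x)"
  "cmp set_cat X Y Z g f = compose X g f"
  by (simp_all add: set_cat_def)

lemma comp_func_simps [simp]:
  "omap (comp_func G F) x = omap G (omap F x)"
  "amap (comp_func G F) x y f = amap G (omap F x) (omap F y) (amap F x y f)"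
  by (simp_all add: comp_func_def)

lemma hom_func_simps [simp]:
  "omap (hom_func C a) x = hom C a x"
  "amap (hom_func C a) x y f = (\<lambda>g\<in>hom C a x. cmp C a x y f g)"
  by (simp_all add: hom_func_def)

lemma directed_posetD:
  assumes "directed_poset I r"
  shows "r \<subseteq> I \<times> I" and "i \<in> I \<Longrightarrow> (i, i) \<in> r" and "(i, j) \<in> r \<Longrightarrow> (j, k) \<in> r \<Longrightarrow> (i, k) \<in> r"
    and "I \<noteq> {}" and "i \<in> I \<Longrightarrow> j \<in> I \<Longrightarrow> \<exists>k\<in>I. (i, k) \<in> r \<and> (j, k) \<in> r"
  using assms unfolding directed_poset_def partial_order_on_def preorder_on_def refl_on_def
  by (auto dest: transD)

lemma is_functorD:
  assumes "is_functor C D F"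
  shows "x \<in> obj C \<Longrightarrow> omap F x \<in> obj D"
    and "x \<in> obj C \<Longrightarrow> y \<in> obj C \<Longrightarrow> f \<in> hom C x y \<Longrightarrow> amap F x y f \<in> hom D (omap F x) (omap F y)"
    and "x \<in> obj C \<Longrightarrow> amap F x x (idn C x) = idn D (omap F x)"
    and "x \<in> obj C \<Longrightarrow> y \<in> obj C \<Longrightarrow> z \<in> obj C \<Longrightarrow> f \<in> hom C x y \<Longrightarrow> g \<in> hom C y z \<Longrightarrow>
      amap F x z (cmp C x y z g f) =
        cmp D (omap F x) (omap F y) (omap F z) (amap F y z g) (amap F x y f)"
  using assms unfolding is_functor_def by blast+

lemma is_coconeD:
  assumes "is_cocone J C F z t"
  shows "z \<in> obj C" and "i \<in> obj J \<Longrightarrow> t i \<in> hom C (omap F i) z"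
    and "i \<in> obj J \<Longrightarrow> j \<in> obj J \<Longrightarrow> u \<in> hom J i j \<Longrightarrow>
      cmp C (omap F i) (omap F j) z (t j) (amap F i j u) = t i"
  using assms unfolding is_cocone_def by blast+

lemma is_colimit_cocone: "is_colimit J C F z t \<Longrightarrow> is_cocone J C F z t"
  unfolding is_colimit_def by blast

lemma is_colimit_ex:
  assumes "is_colimit J C F z t" "is_cocone J C F y s"
  obtains h where "h \<in> hom C z y" "\<And>i. i \<in> obj J \<Longrightarrow> cmp C (omap F i) z y h (t i) = s i"
  using assms unfolding is_colimit_def by blast

lemma is_colimit_unique:
  assumes "is_colimit J C F z t" "is_cocone J C F y s" "h \<in> hom C z y" "h' \<in> hom C z y"
    "\<And>i. i \<in> obj J \<Longrightarrow> cmp C (omap F i) z y h (t i) = s i"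
    "\<And>i. i \<in> obj J \<Longrightarrow> cmp C (omap F i) z y h' (t i) = s i"
  shows "h = h'"
  using assms unfolding is_colimit_def by metis

lemma is_functor_comp_func:
  assumes "is_functor B C F" "is_functor C D G"
  shows "is_functor B D (comp_func G F)"
  using is_functorD[OF assms(1)] is_functorD[OF assms(2)] unfolding is_functor_def by simp

section \<open>Directed colimits of sets\<close>

text \<open>If \<open>z\<close> were missed by all legs, changing the value at \<open>z\<close>
  alone would give two arrows to \<open>{p, q}\<close> that induce the same cocone.\<close>

lemma set_colimit_surj:
  fixes G :: "('j, 'n, 'u set, 'u \<Rightarrow> 'u) func"
  assumes U: "universe TYPE('u)" and G: "is_functor J set_cat G"
    and col: "is_colimit J set_cat G Z \<tau>" and z: "z \<in> Z"
  shows "\<exists>i\<in>obj J. \<exists>x\<in>omap G i. \<tau> i x = z"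
proof (rule ccontr)
  assume neg: "\<not> ?thesis"
  obtain p q :: 'u where pq: "p \<noteq> q" using universe_two_elements[OF U] by blast
  define s where "s = (\<lambda>i. \<lambda>x\<in>omap G i. p)"
  note \<tau> = is_coconeD[OF is_colimit_cocone[OF col], simplified]
  have cocone: "is_cocone J set_cat G {p, q} s"
    unfolding is_cocone_def
  proof (intro conjI ballI)
    show "{p, q} \<in> obj set_cat" by (simp add: small_finite[OF U])
    show "s i \<in> hom set_cat (omap G i) {p, q}" for i by (simp add: s_def)
    show "cmp set_cat (omap G i) (omap G j) {p, q} (s j) (amap G i j u) = s i"
      if "i \<in> obj J" "j \<in> obj J" "u \<in> hom J i j" for i j u
      using is_functorD(2)[OF G that] by (auto simp: s_def compose_def fun_eq_iff dest: PiE_mem)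
  qed
  have "(\<lambda>y\<in>Z. p) = (\<lambda>y\<in>Z. if y = z then q else p)"
  proof (rule is_colimit_unique[OF col cocone])
    fix i assume "i \<in> obj J"
    then show "cmp set_cat (omap G i) Z {p, q} (\<lambda>y\<in>Z. p) (\<tau> i) = s i"
      and "cmp set_cat (omap G i) Z {p, q} (\<lambda>y\<in>Z. if y = z then q else p) (\<tau> i) = s i"
      using \<tau>(2)[of i] neg by (auto simp: s_def compose_def fun_eq_iff dest: PiE_mem)
  qed auto
  then show False using pq z by (auto simp: fun_eq_iff split: if_splits)
qed

lemma set_colimit_identify:
  fixes G :: "('i, unit, 'u set, 'u \<Rightarrow> 'u) func"
  assumes U: "universe TYPE('u)" and dir: "directed_poset I r"
    and G: "is_functor (poset_cat I r) set_cat G"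
    and col: "is_colimit (poset_cat I r) set_cat G Z \<tau>"
    and i: "i \<in> I" and x: "x \<in> omap G i" "x' \<in> omap G i" and eq: "\<tau> i x = \<tau> i x'"
  shows "\<exists>k\<in>I. (i, k) \<in> r \<and> amap G i k () x = amap G i k () x'"
proof -
  note r = directed_posetD[OF dir]
  obtain p q :: 'u where pq: "p \<noteq> q" using universe_two_elements[OF U] by blast
  have map: "amap G j k () y \<in> omap G k" if "(j, k) \<in> r" "y \<in> omap G j" for j k y
    using is_functorD(2)[OF G, of j k "()"] that r(1) by (auto dest: PiE_mem)
  have comp: "amap G j l () y = amap G k l () (amap G j k () y)"
    if "(j, k) \<in> r" "(k, l) \<in> r" "y \<in> omap G j" for j k l y
  proof -
    have "j \<in> I" "k \<in> I" "l \<in> I" using that r(1) by auto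
    then have "amap G j l () = compose (omap G j) (amap G k l ()) (amap G j k ())"
      using is_functorD(4)[OF G, of j k l "()" "()"] that by simp
    then show ?thesis using that by (simp add: compose_eq)
  qed
  define E where "E = (\<lambda>k y. \<exists>l. (i, l) \<in> r \<and> (k, l) \<in> r \<and> amap G k l () y = amap G i l () x)"
  \<comment> \<open>The two-valued cocone detecting which elements become equal to \<open>x\<close> at a later stage.\<close>
  define s where "s = (\<lambda>k. \<lambda>y\<in>omap G k. if E k y then p else q)"
  \<comment> \<open>Invariance of \<open>E\<close> along the transition maps is the cocone condition
    for \<open>s\<close>. Going forward, the witness \<open>l\<close> and the index \<open>k\<close>
    are replaced by a common upper bound.\<close>
  have E: "E k (amap G j k () y) \<longleftrightarrow> E j y" if jk: "(j, k) \<in> r" and y: "y \<in> omap G j" for j k y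
  proof
    assume "E k (amap G j k () y)"
    then show "E j y" unfolding E_def using comp[OF jk _ y] r(3)[OF jk] by metis
  next
    assume "E j y"
    then obtain l where l: "(i, l) \<in> r" "(j, l) \<in> r" "amap G j l () y = amap G i l () x"
      unfolding E_def by blast
    obtain m where m: "(l, m) \<in> r" "(k, m) \<in> r" using r(5)[of l k] r(1) l jk by blast
    have "amap G k m () (amap G j k () y) = amap G j m () y" using comp[OF jk m(2) y] by simp
    also have "\<dots> = amap G l m () (amap G j l () y)" using comp[OF l(2) m(1) y] .
    also have "\<dots> = amap G i m () x" using comp[OF l(1) m(1) x(1)] l(3) by simp
    finally show "E k (amap G j k () y)" unfolding E_def using m l r(3) by blast
  qed
  have cocone: "is_cocone (poset_cat I r) set_cat G {p, q} s"
    unfolding is_cocone_def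
  proof (intro conjI ballI)
    show "{p, q} \<in> obj set_cat" by (simp add: small_finite[OF U])
    show "s i \<in> hom set_cat (omap G i) {p, q}" for i by (simp add: s_def)
    show "cmp set_cat (omap G j) (omap G k) {p, q} (s k) (amap G j k u) = s j"
      if "u \<in> hom (poset_cat I r) j k" for j k u
      using that by (auto simp: s_def compose_def fun_eq_iff map E)
  qed
  obtain h where h: "\<And>k. k \<in> I \<Longrightarrow> compose (omap G k) h (\<tau> k) = s k"
    using is_colimit_ex[OF col cocone] by (metis poset_cat_simps(1) set_cat_simps(4))
  have "s i x = s i x'" using h[OF i] x eq by (metis compose_eq)
  moreover have "E i x" unfolding E_def using r(2)[OF i] by blast
  ultimately have "E i x'" using x pq by (simp add: s_def split: if_splits)
  then show ?thesis unfolding E_def using r(1) by force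
qed

text \<open>Converse of the two preceding lemmas. The induced map evaluates the given cocone at a
  chosen representative; the hypotheses \<open>surj\<close> and \<open>ident\<close> make it total
  and independent of the choice.\<close>

lemma set_colimitI:
  fixes G :: "('i, unit, 'u set, 'u \<Rightarrow> 'u) func"
  assumes dir: "directed_poset I r"
    and G: "is_functor (poset_cat I r) set_cat G"
    and \<tau>: "is_cocone (poset_cat I r) set_cat G Z \<tau>"
    and surj: "\<And>z. z \<in> Z \<Longrightarrow> \<exists>i\<in>I. \<exists>x\<in>omap G i. \<tau> i x = z"
    and ident: "\<And>i x x'. i \<in> I \<Longrightarrow> x \<in> omap G i \<Longrightarrow> x' \<in> omap G i \<Longrightarrow> \<tau> i x = \<tau> i x' \<Longrightarrow>
      \<exists>k\<in>I. (i, k) \<in> r \<and> amap G i k () x = amap G i k () x'"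
  shows "is_colimit (poset_cat I r) set_cat G Z \<tau>"
  unfolding is_colimit_def
proof (intro conjI allI impI \<tau>)
  note r = directed_posetD[OF dir]
  fix Y s assume s: "is_cocone (poset_cat I r) set_cat G Y s"
  have map: "amap G j k () y \<in> omap G k" if "(j, k) \<in> r" "y \<in> omap G j" for j k y
    using is_functorD(2)[OF G, of j k "()"] that r(1) by (auto dest: PiE_mem)
  have cc: "T k (amap G j k () y) = T j y"
    if "is_cocone (poset_cat I r) set_cat G W T" "(j, k) \<in> r" "y \<in> omap G j" for W T j k y
  proof -
    have "j \<in> I" "k \<in> I" using that r(1) by auto
    then have "compose (omap G j) (T k) (amap G j k ()) = T j"
      using is_coconeD(3)[OF that(1), of j k "()"] that by simp
    then show ?thesis using that by (metis compose_eq)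
  qed
  \<comment> \<open>Representatives at different indices are first moved to a common stage
    \<open>k\<close>, since \<open>ident\<close> compares elements at one index only.\<close>
  have wd: "s i x = s j y"
    if ij: "i \<in> I" "j \<in> I" "x \<in> omap G i" "y \<in> omap G j" "\<tau> i x = \<tau> j y" for i j x y
  proof -
    obtain k where k: "(i, k) \<in> r" "(j, k) \<in> r" "k \<in> I" using r(5) ij by blast
    have "\<tau> k (amap G i k () x) = \<tau> k (amap G j k () y)"
      using cc[OF \<tau> k(1) ij(3)] cc[OF \<tau> k(2) ij(4)] ij(5) by simp
    then obtain l where l: "(k, l) \<in> r"
      "amap G k l () (amap G i k () x) = amap G k l () (amap G j k () y)"
      using ident[OF k(3) map[OF k(1) ij(3)] map[OF k(2) ij(4)]] by blast
    have "s i x = s l (amap G k l () (amap G i k () x))"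
      using cc[OF s k(1) ij(3)] cc[OF s l(1) map[OF k(1) ij(3)]] by simp
    also have "\<dots> = s j y"
      using cc[OF s k(2) ij(4)] cc[OF s l(1) map[OF k(2) ij(4)]] l(2) by simp
    finally show ?thesis .
  qed
  define h where "h = (\<lambda>z\<in>Z. SOME w. \<exists>i\<in>I. \<exists>x\<in>omap G i. \<tau> i x = z \<and> w = s i x)"
  have h: "h (\<tau> i x) = s i x" if "i \<in> I" "x \<in> omap G i" for i x
  proof -
    have "\<tau> i x \<in> Z" using is_coconeD(2)[OF \<tau>, of i] that by (auto dest: PiE_mem)
    then have "h (\<tau> i x) = (SOME w. \<exists>j\<in>I. \<exists>y\<in>omap G j. \<tau> j y = \<tau> i x \<and> w = s j y)"
      by (simp add: h_def)
    moreover have "\<exists>j\<in>I. \<exists>y\<in>omap G j. \<tau> j y = \<tau> i x \<and>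
        (SOME w. \<exists>j\<in>I. \<exists>y\<in>omap G j. \<tau> j y = \<tau> i x \<and> w = s j y) = s j y"
      by (rule someI[where x = "s i x"]) (use that in blast)
    ultimately obtain j y where "j \<in> I" "y \<in> omap G j" "\<tau> j y = \<tau> i x" "h (\<tau> i x) = s j y" by metis
    then show ?thesis using wd[of j i y x] that by simp
  qed
  show "\<exists>!h. h \<in> hom set_cat Z Y \<and> (\<forall>i\<in>obj (poset_cat I r). cmp set_cat (omap G i) Z Y h (\<tau> i) = s i)"
  proof (rule ex1I[of _ h], intro conjI ballI)
    show "h \<in> hom set_cat Z Y"
    proof (simp, rule PiE_I)
      fix z assume "z \<in> Z"
      then obtain i x where "i \<in> I" "x \<in> omap G i" "\<tau> i x = z" using surj by blast
      then show "h z \<in> Y" using h[of i x] is_coconeD(2)[OF s, of i] by (auto dest: PiE_mem)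
    qed (simp add: h_def)
    show "cmp set_cat (omap G i) Z Y h (\<tau> i) = s i" if "i \<in> obj (poset_cat I r)" for i
      using h[of i] that is_coconeD(2)[OF s, of i]
      by (auto simp: compose_def fun_eq_iff dest: PiE_arb)
    fix h' assume "h' \<in> hom set_cat Z Y \<and>
      (\<forall>i\<in>obj (poset_cat I r). cmp set_cat (omap G i) Z Y h' (\<tau> i) = s i)"
    then have h'Z: "h' \<in> Z \<rightarrow>\<^sub>E Y" and h': "\<And>i. i \<in> I \<Longrightarrow> compose (omap G i) h' (\<tau> i) = s i" by auto
    show "h' = h"
    proof
      fix z show "h' z = h z"
      proof (cases "z \<in> Z")
        case True
        then obtain i x where "i \<in> I" "x \<in> omap G i" "\<tau> i x = z" using surj by blast
        then show ?thesis using h[of i x] h'[of i] by (metis compose_eq)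
      qed (use h'Z in \<open>auto simp: h_def dest: PiE_arb\<close>)
    qed
  qed
qed

section \<open>Hom-functors on directed colimits\<close>

text \<open>The elementwise form of the statement that the hom-functor of \<open>c\<close> preserves
  this colimit: every arrow into the colimit factors through a stage, and two factorizations at one
  stage agree later. The index type is arbitrary, so the condition also makes sense for posets
  outside \<open>'u\<close>.\<close>

definition hom_commutes where
  "hom_commutes C c I r F z t \<longleftrightarrow>
     (\<forall>g\<in>hom C c z. \<exists>i\<in>I. \<exists>f\<in>hom C c (omap F i). cmp C c (omap F i) z (t i) f = g) \<and>
     (\<forall>i\<in>I. \<forall>f\<in>hom C c (omap F i). \<forall>f'\<in>hom C c (omap F i).
        cmp C c (omap F i) z (t i) f = cmp C c (omap F i) z (t i) f' \<longrightarrow>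
        (\<exists>k\<in>I. (i, k) \<in> r \<and> cmp C c (omap F i) (omap F k) (amap F i k ()) f =
           cmp C c (omap F i) (omap F k) (amap F i k ()) f'))"

lemma is_functor_hom_func:
  assumes C: "category C" and ls: "locally_small C" and c: "c \<in> obj C"
  shows "is_functor C set_cat (hom_func C c)"
  unfolding is_functor_def
proof (intro conjI ballI)
  show "omap (hom_func C c) x \<in> obj set_cat" if "x \<in> obj C" for x
    using ls c that by (simp add: locally_small_def)
  show "amap (hom_func C c) x y f \<in> hom set_cat (omap (hom_func C c) x) (omap (hom_func C c) y)"
    if "x \<in> obj C" "y \<in> obj C" "f \<in> hom C x y" for x y f
    using C c that by (auto simp: category_def)
  show "amap (hom_func C c) x x (idn C x) = idn set_cat (omap (hom_func C c) x)" if "x \<in> obj C" for x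
    using C c that by (auto simp: category_def fun_eq_iff)
  show "amap (hom_func C c) x z (cmp C x y z g f) =
      cmp set_cat (omap (hom_func C c) x) (omap (hom_func C c) y) (omap (hom_func C c) z)
        (amap (hom_func C c) y z g) (amap (hom_func C c) x y f)"
    if "x \<in> obj C" "y \<in> obj C" "z \<in> obj C" "f \<in> hom C x y" "g \<in> hom C y z" for x y z f g
    using C c that by (auto simp: category_def fun_eq_iff compose_def)
qed

lemma is_cocone_functor:
  assumes "is_cocone J C F z t" "is_functor J C F" "is_functor C D G"
  shows "is_cocone J D (comp_func G F) (omap G z) (\<lambda>i. amap G (omap F i) z (t i))"
  unfolding is_cocone_def
proof (intro conjI ballI)
  note t = is_coconeD[OF assms(1)] and F = is_functorD[OF assms(2)] and G = is_functorD[OF assms(3)]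
  show "omap G z \<in> obj D" using t G by blast
  show "amap G (omap F i) z (t i) \<in> hom D (omap (comp_func G F) i) (omap G z)" if "i \<in> obj J" for i
    using t G F that by simp
  show "cmp D (omap (comp_func G F) i) (omap (comp_func G F) j) (omap G z)
      (amap G (omap F j) z (t j)) (amap (comp_func G F) i j u) = amap G (omap F i) z (t i)"
    if "i \<in> obj J" "j \<in> obj J" "u \<in> hom J i j" for i j u
    using t F that by (simp add: G(4)[symmetric])
qed

lemma hom_commutes_iff_is_colimit:
  fixes C :: "('o, 'u) cat"
  assumes U: "universe TYPE('u)" and C: "category C" and ls: "locally_small C" and c: "c \<in> obj C"
    and dir: "directed_poset I r" and F: "is_functor (poset_cat I r) C F"
    and t: "is_cocone (poset_cat I r) C F z t"
  shows "is_colimit (poset_cat I r) set_cat (comp_func (hom_func C c) F)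
      (omap (hom_func C c) z) (\<lambda>i. amap (hom_func C c) (omap F i) z (t i)) \<longleftrightarrow>
    hom_commutes C c I r F z t" (is "?col \<longleftrightarrow> _")
proof
  let ?G = "comp_func (hom_func C c) F"
  have G: "is_functor (poset_cat I r) set_cat ?G"
    using is_functor_comp_func[OF F is_functor_hom_func[OF C ls c]] .
  show "hom_commutes C c I r F z t" if ?col
    unfolding hom_commutes_def
    using set_colimit_surj[OF U G that] set_colimit_identify[OF U dir G that]
    by simp
  show ?col if "hom_commutes C c I r F z t"
  proof (rule set_colimitI[OF dir G is_cocone_functor[OF t F is_functor_hom_func[OF C ls c]]])
    show "\<exists>i\<in>I. \<exists>x\<in>omap ?G i. amap (hom_func C c) (omap F i) z (t i) x = g"
      if "g \<in> omap (hom_func C c) z" for g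
      using that \<open>hom_commutes C c I r F z t\<close> unfolding hom_commutes_def by fastforce
    show "\<exists>k\<in>I. (i, k) \<in> r \<and> amap ?G i k () f = amap ?G i k () f'"
      if "i \<in> I" "f \<in> omap ?G i" "f' \<in> omap ?G i"
        "amap (hom_func C c) (omap F i) z (t i) f = amap (hom_func C c) (omap F i) z (t i) f'" for i f f'
      using that \<open>hom_commutes C c I r F z t\<close> unfolding hom_commutes_def by simp
  qed
qed


section \<open>Colimits indexed by small posets of any type\<close>

text \<open>Cocones only see the set of transition arrows between two indices, not the arrows of the index category.\<close>

lemma is_colimit_reindex:
  assumes \<phi>: "bij_betw \<phi> (obj J) (obj K)"
    and o: "\<And>i. i \<in> obj J \<Longrightarrow> omap F i = omap F' (\<phi> i)"
    and a: "\<And>i j. i \<in> obj J \<Longrightarrow> j \<in> obj J \<Longrightarrow>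
      amap F i j ` hom J i j = amap F' (\<phi> i) (\<phi> j) ` hom K (\<phi> i) (\<phi> j)"
    and col: "is_colimit K C F' z t"
  shows "is_colimit J C F z (\<lambda>i. t (\<phi> i))"
proof -
  have K: "obj K = \<phi> ` obj J" using \<phi> by (simp add: bij_betw_imp_surj_on)
  define \<psi> where "\<psi> = the_inv_into (obj J) \<phi>"
  have \<psi>: "\<psi> (\<phi> i) = i" if "i \<in> obj J" for i
    using \<phi> that unfolding \<psi>_def by (simp add: bij_betw_def the_inv_into_f_f)
  have cocone: "is_cocone J C F y s \<longleftrightarrow> is_cocone K C F' y s'"
    if s: "\<And>i. i \<in> obj J \<Longrightarrow> s i = s' (\<phi> i)" for y s s'
  proof -
    have "(\<forall>u\<in>hom J i j. cmp C (omap F i) (omap F j) y (s j) (amap F i j u) = s i) \<longleftrightarrow>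
      (\<forall>u\<in>hom K (\<phi> i) (\<phi> j).
        cmp C (omap F' (\<phi> i)) (omap F' (\<phi> j)) y (s' (\<phi> j)) (amap F' (\<phi> i) (\<phi> j) u) = s' (\<phi> i))"
      if "i \<in> obj J" "j \<in> obj J" for i j
    proof -
      have "(\<forall>f\<in>amap F i j ` hom J i j. cmp C (omap F i) (omap F j) y (s j) f = s i) \<longleftrightarrow>
        (\<forall>f\<in>amap F' (\<phi> i) (\<phi> j) ` hom K (\<phi> i) (\<phi> j).
          cmp C (omap F' (\<phi> i)) (omap F' (\<phi> j)) y (s' (\<phi> j)) f = s' (\<phi> i))"
        using a[OF that] o s that by simp
      then show ?thesis by simp
    qed
    then show ?thesis unfolding is_cocone_def K using o s by simp
  qed
  show ?thesis
    unfolding is_colimit_def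
  proof (intro conjI allI impI)
    show "is_cocone J C F z (\<lambda>i. t (\<phi> i))"
      using cocone[of "\<lambda>i. t (\<phi> i)" t] is_colimit_cocone[OF col] by simp
    fix y s assume s: "is_cocone J C F y s"
    then have "is_cocone K C F' y (\<lambda>k. s (\<psi> k))"
      using cocone[of s "\<lambda>k. s (\<psi> k)"] \<psi> by simp
    then have "\<exists>!h. h \<in> hom C z y \<and> (\<forall>i\<in>obj K. cmp C (omap F' i) z y h (t i) = s (\<psi> i))"
      using col unfolding is_colimit_def by blast
    then show "\<exists>!h. h \<in> hom C z y \<and> (\<forall>i\<in>obj J. cmp C (omap F i) z y h (t (\<phi> i)) = s i)"
      unfolding K using o \<psi> by simp
  qed
qed

lemma image_hom_poset_cat:
  "f ` hom (poset_cat I r) i j = {y. y = f () \<and> (i, j) \<in> r}"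
  by (auto simp: poset_cat_def)

section \<open>Monomorphisms and strong epimorphisms\<close>

lemma monicD:
  assumes "monic C x y m"
  shows "m \<in> hom C x y"
    and "w \<in> obj C \<Longrightarrow> g \<in> hom C w x \<Longrightarrow> h \<in> hom C w x \<Longrightarrow> cmp C w x y m g = cmp C w x y m h \<Longrightarrow> g = h"
  using assms unfolding monic_def by blast+

text \<open>An epi with the diagonal property against monos. Only the upper triangle is demanded of
  the diagonal: cancelling \<open>e\<close> yields the lower one, as in
  \<open>strong_epi_lift\<close>.\<close>

definition strong_epi :: "('o, 'm) cat \<Rightarrow> 'o \<Rightarrow> 'o \<Rightarrow> 'm \<Rightarrow> bool" where
  "strong_epi C x y e \<longleftrightarrow> e \<in> hom C x y \<and>
     (\<forall>w\<in>obj C. \<forall>g\<in>hom C y w. \<forall>h\<in>hom C y w. cmp C x y w g e = cmp C x y w h e \<longrightarrow> g = h) \<and>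
     (\<forall>w\<in>obj C. \<forall>z\<in>obj C. \<forall>m u v. monic C w z m \<longrightarrow> u \<in> hom C x w \<longrightarrow> v \<in> hom C y z \<longrightarrow>
        cmp C x w z m u = cmp C x y z v e \<longrightarrow> (\<exists>d\<in>hom C y w. cmp C x y w d e = u))"

lemma strong_epiD:
  assumes "strong_epi C x y e"
  shows "e \<in> hom C x y"
    and "w \<in> obj C \<Longrightarrow> g \<in> hom C y w \<Longrightarrow> h \<in> hom C y w \<Longrightarrow> cmp C x y w g e = cmp C x y w h e \<Longrightarrow> g = h"
  using assms unfolding strong_epi_def by blast+

section \<open>Basic properties of a locally finitely presentable category\<close>

locale lfp_cat =
  fixes A :: "('o, 'u) cat"
  assumes U: "universe TYPE('u)" and lfp: "locally_finitely_presentable A"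
begin

lemma cat: "category A" and ls: "locally_small A" and cc: "cocomplete A"
  using lfp unfolding locally_finitely_presentable_def by blast+

lemma cmp_hom [simp]:
  "f \<in> hom A x y \<Longrightarrow> g \<in> hom A y z \<Longrightarrow> x \<in> obj A \<Longrightarrow> y \<in> obj A \<Longrightarrow> z \<in> obj A \<Longrightarrow>
    cmp A x y z g f \<in> hom A x z"
  and idn_hom [simp]: "x \<in> obj A \<Longrightarrow> idn A x \<in> hom A x x"
  and cmp_idn [simp]:
  "f \<in> hom A x y \<Longrightarrow> x \<in> obj A \<Longrightarrow> y \<in> obj A \<Longrightarrow> cmp A x x y f (idn A x) = f"
  "f \<in> hom A x y \<Longrightarrow> x \<in> obj A \<Longrightarrow> y \<in> obj A \<Longrightarrow> cmp A x y y (idn A y) f = f"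
  using cat unfolding category_def by blast+

lemma cmp_assoc:
  "f \<in> hom A w x \<Longrightarrow> g \<in> hom A x y \<Longrightarrow> h \<in> hom A y z \<Longrightarrow>
    w \<in> obj A \<Longrightarrow> x \<in> obj A \<Longrightarrow> y \<in> obj A \<Longrightarrow> z \<in> obj A \<Longrightarrow>
    cmp A w y z h (cmp A w x y g f) = cmp A w x z (cmp A x y z h g) f"
  using cat unfolding category_def by blast

abbreviation "fp \<equiv> fp_objects A"

lemma fp_obj [simp]: "p \<in> fp \<Longrightarrow> p \<in> obj A"
  unfolding fp_objects_def by blast

lemma fp_hom_commutes:
  assumes "p \<in> fp" "directed_diagram I r A F" "is_colimit (poset_cat I r) A F z t"
  shows "hom_commutes A p I r F z t"
proof -
  have d: "directed_poset I r" "is_functor (poset_cat I r) A F"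
    using assms(2) unfolding directed_diagram_def by blast+
  show ?thesis
    using assms hom_commutes_iff_is_colimit[OF U cat ls fp_obj[OF assms(1)] d is_colimit_cocone[OF assms(3)]]
    unfolding fp_objects_def preserves_directed_colimits_def preserves_colimits_of_def by blast
qed

text \<open>Cocompleteness and finite presentability speak of index sets inside \<open>'u\<close>,
  whereas the diagrams below are indexed by sum types or natural numbers. The poset is carried into
  \<open>'u\<close> along an injection \<open>\<phi>\<close>, and the colimit is carried
  back.\<close>

lemma poset_colimit_exists:
  fixes I :: "'i set"
  assumes I: "small TYPE('u) I" and r: "preorder_on I r" and F: "is_functor (poset_cat I r) A F"
  obtains z t where "is_colimit (poset_cat I r) A F z t"
    and "\<And>p. directed_poset I r \<Longrightarrow> p \<in> fp \<Longrightarrow> hom_commutes A p I r F z t"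
proof -
  obtain \<phi> :: "'i \<Rightarrow> 'u" where \<phi>: "inj_on \<phi> I" using small_embedding[OF I] by blast
  define \<psi> where "\<psi> = the_inv_into I \<phi>"
  have \<psi> [simp]: "\<psi> (\<phi> i) = i" if "i \<in> I" for i
    using \<phi> that unfolding \<psi>_def by (simp add: the_inv_into_f_f)
  have sub: "r \<subseteq> I \<times> I" and refl: "\<And>i. i \<in> I \<Longrightarrow> (i, i) \<in> r"
    and tr: "\<And>i j k. (i, j) \<in> r \<Longrightarrow> (j, k) \<in> r \<Longrightarrow> (i, k) \<in> r"
    using r unfolding preorder_on_def refl_on_def by (auto dest: transD)
  define r' where "r' = {(\<phi> i, \<phi> j) | i j. (i, j) \<in> r}"
  have r': "(\<phi> i, \<phi> j) \<in> r' \<longleftrightarrow> (i, j) \<in> r" if "i \<in> I" "j \<in> I" for i j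
    using that sub \<psi> unfolding r'_def by (auto 0 4) (metis SigmaD1 SigmaD2 \<psi> subsetD)
  have sI: "small TYPE('u) (\<phi> ` I)" using I by (rule small_image)
  \<comment> \<open>A single label serves for all arrows of the thin category \<open>J\<close>. The
    diagram is needed twice: \<open>F'\<close> has index arrows in \<open>'u\<close>, as
    \<open>cocomplete\<close> demands, and \<open>F''\<close> has arrows of type
    \<open>unit\<close>, as \<open>directed_diagram\<close> demands.\<close>
  define c :: 'u where "c = undefined"
  define J :: "('u, 'u) cat" where
    "J = \<lparr>obj = \<phi> ` I, hom = (\<lambda>u v. {w. w = c \<and> (u, v) \<in> r'}), idn = (\<lambda>_. c), cmp = (\<lambda>_ _ _ _ _. c)\<rparr>"
  define F' :: "('u, 'u, 'o, 'u) func" where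
    "F' = \<lparr>omap = (\<lambda>u. omap F (\<psi> u)), amap = (\<lambda>u v _. amap F (\<psi> u) (\<psi> v) ())\<rparr>"
  define F'' :: "('u, unit, 'o, 'u) func" where
    "F'' = \<lparr>omap = (\<lambda>u. omap F (\<psi> u)), amap = (\<lambda>u v _. amap F (\<psi> u) (\<psi> v) ())\<rparr>"
  note Fd = is_functorD[OF F]
  have Fcmp: "amap F i k () = cmp A (omap F i) (omap F j) (omap F k) (amap F j k ()) (amap F i j ())"
    if "(i, j) \<in> r" "(j, k) \<in> r" for i j k
    using Fd(4)[of i j k "()" "()"] that sub by auto
  have "category J"
    unfolding category_def J_def by (auto simp: r' refl dest: tr)
  moreover have "locally_small J"
    unfolding locally_small_def J_def by (auto intro!: small_finite[OF U])
  ultimately have J: "small_category J"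
    using sI unfolding small_category_def by (simp add: J_def)
  have F': "is_functor J A F'"
    unfolding is_functor_def J_def F'_def using Fd by (auto simp: r' intro: Fcmp)
  have F'': "is_functor (poset_cat (\<phi> ` I) r') A F''"
    unfolding is_functor_def F''_def using Fd by (auto simp: r' intro: Fcmp)
  obtain z t where col: "is_colimit J A F' z t"
    using cc J F' unfolding cocomplete_def by blast
  have col'': "is_colimit (poset_cat (\<phi> ` I) r') A F'' z t"
    by (rule is_colimit_reindex[where \<phi>="\<lambda>x. x" and t=t, OF _ _ _ col])
      (auto simp: J_def F'_def F''_def image_hom_poset_cat bij_betw_def)
  have "is_colimit (poset_cat I r) A F z (\<lambda>i. t (\<phi> i))"
    by (rule is_colimit_reindex[OF _ _ _ col''])
      (use \<phi> in \<open>auto simp: F''_def bij_betw_def image_hom_poset_cat r'\<close>)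
  moreover have "hom_commutes A p I r F z (\<lambda>i. t (\<phi> i))" if dir: "directed_poset I r" and p: "p \<in> fp" for p
  proof -
    have "directed_poset (\<phi> ` I) r'"
      unfolding directed_poset_def partial_order_on_def preorder_on_def
    proof (intro conjI)
      show "r' \<subseteq> \<phi> ` I \<times> \<phi> ` I" using sub unfolding r'_def by auto
      show "refl_on (\<phi> ` I) r'" using refl unfolding refl_on_def r'_def by auto
      show "trans r'"
        unfolding r'_def trans_def using sub tr \<phi> by (auto dest!: inj_onD) (metis SigmaD1 SigmaD2 \<psi> subsetD)
      show "antisym r'"
        using dir sub \<psi> unfolding r'_def directed_poset_def partial_order_on_def antisym_def
        by auto (metis SigmaD1 SigmaD2 \<psi> subsetD)
      show "\<phi> ` I \<noteq> {}" using dir unfolding directed_poset_def by auto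
      show "\<forall>i\<in>\<phi> ` I. \<forall>j\<in>\<phi> ` I. \<exists>k\<in>\<phi> ` I. (i, k) \<in> r' \<and> (j, k) \<in> r'"
        using directed_posetD(5)[OF dir] by (fastforce simp: r')
    qed
    then have "hom_commutes A p (\<phi> ` I) r' F'' z t"
      using fp_hom_commutes[OF p _ col''] F'' sI unfolding directed_diagram_def by blast
    then show ?thesis
      unfolding hom_commutes_def by (simp add: F''_def r')
  qed
  ultimately show thesis using that by blast
qed

section \<open>Strong epimorphisms and image factorization\<close>

lemmas cmp_assoc_right = cmp_assoc[symmetric]

text \<open>Composing \<open>h\<close> with the legs gives a cocone, and both arrows are induced by
  it.\<close>

lemma colimit_legs_epi:
  assumes "is_colimit J A F z t" "is_functor J A F" "category J"
    and h: "h \<in> hom A z y" "h' \<in> hom A z y" and y: "y \<in> obj A"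
    and eq: "\<And>i. i \<in> obj J \<Longrightarrow> cmp A (omap F i) z y h (t i) = cmp A (omap F i) z y h' (t i)"
  shows "h = h'"
proof (rule is_colimit_unique[OF assms(1) _ h])
  note t = is_coconeD[OF is_colimit_cocone[OF assms(1)]] and F = is_functorD[OF assms(2)]
  show "is_cocone J A F y (\<lambda>i. cmp A (omap F i) z y h (t i))"
    unfolding is_cocone_def using t F h y by (simp add: cmp_assoc_right)
qed (simp_all add: eq)

lemma category_poset_cat: "preorder_on I r \<Longrightarrow> category (poset_cat I r)"
  unfolding category_def preorder_on_def refl_on_def by (auto dest: transD)

lemma fp_presentation:
  assumes "x \<in> obj A"
  obtains I r F t where "directed_diagram I r A F" "\<And>i. i \<in> I \<Longrightarrow> omap F i \<in> fp"
    "is_colimit (poset_cat I r) A F x t"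
  using assms lfp unfolding locally_finitely_presentable_def by (metis image_subset_iff)

lemma directed_diagramD:
  assumes "directed_diagram I r C F"
  shows "directed_poset I r" "is_functor (poset_cat I r) C F" "preorder_on I r"
  using assms unfolding directed_diagram_def directed_poset_def partial_order_on_def by blast+

text \<open>The legs of a presentation of \<open>x\<close> are jointly epic and have finitely
  presentable domains.\<close>

lemma fp_separates:
  assumes x: "x \<in> obj A" and y: "y \<in> obj A" and h: "h \<in> hom A x y" "h' \<in> hom A x y"
    and eq: "\<And>p u. p \<in> fp \<Longrightarrow> u \<in> hom A p x \<Longrightarrow> cmp A p x y h u = cmp A p x y h' u"
  shows "h = h'"
proof -
  obtain I r F t where D: "directed_diagram I r A F" and p: "\<And>i. i \<in> I \<Longrightarrow> omap F i \<in> fp"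
    and col: "is_colimit (poset_cat I r) A F x t" using fp_presentation[OF x] by blast
  note D = directed_diagramD[OF D]
  show ?thesis
    by (rule colimit_legs_epi[OF col D(2) category_poset_cat[OF D(3)] h y], rule eq)
      (use p is_coconeD(2)[OF is_colimit_cocone[OF col]] in simp_all)
qed

lemma monicI_fp:
  assumes m: "m \<in> hom A x y" and x: "x \<in> obj A" and y: "y \<in> obj A"
    and inj: "\<And>p u v. p \<in> fp \<Longrightarrow> u \<in> hom A p x \<Longrightarrow> v \<in> hom A p x \<Longrightarrow>
      cmp A p x y m u = cmp A p x y m v \<Longrightarrow> u = v"
  shows "monic A x y m"
  unfolding monic_def
proof (intro conjI ballI impI m)
  fix w g h assume w: "w \<in> obj A" and g: "g \<in> hom A w x" and h: "h \<in> hom A w x"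
    and eq: "cmp A w x y m g = cmp A w x y m h"
  show "g = h"
  proof (rule fp_separates[OF w x g h])
    fix p u assume p: "p \<in> fp" and u: "u \<in> hom A p w"
    have "cmp A p x y m (cmp A p w x g u) = cmp A p x y m (cmp A p w x h u)"
      using cmp_assoc[OF u g m] cmp_assoc[OF u h m] eq p w x y by simp
    then show "cmp A p w x g u = cmp A p w x h u"
      by (rule inj[OF p cmp_hom[OF u g fp_obj[OF p] w x] cmp_hom[OF u h fp_obj[OF p] w x]])
  qed
qed

lemma strong_epi_lift:
  assumes e: "strong_epi A x y e" and m: "monic A w z m" and u: "u \<in> hom A x w" and v: "v \<in> hom A y z"
    and eq: "cmp A x w z m u = cmp A x y z v e"
    and o: "x \<in> obj A" "y \<in> obj A" "w \<in> obj A" "z \<in> obj A"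
  obtains d where "d \<in> hom A y w" "cmp A x y w d e = u" "cmp A y w z m d = v"
proof -
  obtain d where d: "d \<in> hom A y w" "cmp A x y w d e = u"
    using e m u v eq o unfolding strong_epi_def by blast
  have "cmp A x y z (cmp A y w z m d) e = cmp A x y z v e"
    using d eq o strong_epiD(1)[OF e] monicD(1)[OF m] by (simp add: cmp_assoc_right)
  then have "cmp A y w z m d = v"
    by (rule strong_epiD(2)[OF e o(4) cmp_hom[OF d(1) monicD(1)[OF m] o(2,3,4)] v])
  then show thesis using d that by blast
qed

lemma strong_epi_idn: "x \<in> obj A \<Longrightarrow> strong_epi A x x (idn A x)"
  unfolding strong_epi_def by auto

lemma strong_epi_cmp:
  assumes e: "strong_epi A x y e" and f: "strong_epi A y z f"
    and o: "x \<in> obj A" "y \<in> obj A" "z \<in> obj A"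
  shows "strong_epi A x z (cmp A x y z f e)"
  unfolding strong_epi_def
proof (intro conjI ballI allI impI)
  note eh = strong_epiD(1)[OF e] strong_epiD(1)[OF f]
  show "cmp A x y z f e \<in> hom A x z" using eh o by simp
  fix w assume w: "w \<in> obj A"
  show "g = h" if "g \<in> hom A z w" "h \<in> hom A z w"
    "cmp A x z w g (cmp A x y z f e) = cmp A x z w h (cmp A x y z f e)" for g h
  proof -
    have "cmp A y z w g f = cmp A y z w h f"
      by (rule strong_epiD(2)[OF e w]) (use that eh o w in \<open>simp_all add: cmp_assoc_right\<close>)
    then show ?thesis using strong_epiD(2)[OF f w] that by blast
  qed
  fix q m u v assume q: "q \<in> obj A" and m: "monic A w q m" and u: "u \<in> hom A x w" and v: "v \<in> hom A z q"
    and eq: "cmp A x w q m u = cmp A x z q v (cmp A x y z f e)"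
  have "cmp A x w q m u = cmp A x y q (cmp A y z q v f) e"
    using eq eh v o q by (simp add: cmp_assoc_right)
  then obtain d where d: "d \<in> hom A y w" "cmp A x y w d e = u" "cmp A y w q m d = cmp A y z q v f"
    using strong_epi_lift[OF e m u cmp_hom[OF eh(2) v o(2,3) q] _ o(1,2) w q] by blast
  obtain d' where "d' \<in> hom A z w" "cmp A y z w d' f = d"
    using strong_epi_lift[OF f m d(1) v d(3) o(2,3) w q] by blast
  then show "\<exists>d\<in>hom A z w. cmp A x z w d (cmp A x y z f e) = u"
    using d eh o w by (intro bexI[of _ d']) (simp_all add: cmp_assoc)
qed

lemma monic_cmp:
  assumes m: "monic A x y m" and n: "monic A y z n" and o: "x \<in> obj A" "y \<in> obj A" "z \<in> obj A"
  shows "monic A x z (cmp A x y z n m)"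
  unfolding monic_def
proof (intro conjI ballI impI)
  note h = monicD(1)[OF m] monicD(1)[OF n]
  show "cmp A x y z n m \<in> hom A x z" using h o by simp
  fix w u v assume w: "w \<in> obj A" and u: "u \<in> hom A w x" and v: "v \<in> hom A w x"
    and eq: "cmp A w x z (cmp A x y z n m) u = cmp A w x z (cmp A x y z n m) v"
  have "cmp A w x y m u = cmp A w x y m v"
    by (rule monicD(2)[OF n w]) (use w u v h o eq in \<open>simp_all add: cmp_assoc_right\<close>)
  then show "u = v" using monicD(2)[OF m w u v] by blast
qed

lemma monic_cancel:
  assumes nm: "monic A x z (cmp A x y z n m)" and m: "m \<in> hom A x y" and n: "n \<in> hom A y z"
    and o: "x \<in> obj A" "y \<in> obj A" "z \<in> obj A"
  shows "monic A x y m"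
  unfolding monic_def
proof (intro conjI ballI impI m)
  fix w u v assume w: "w \<in> obj A" and u: "u \<in> hom A w x" and v: "v \<in> hom A w x"
    and eq: "cmp A w x y m u = cmp A w x y m v"
  then show "u = v"
    by (intro monicD(2)[OF nm w u v]) (use u v m n o w in \<open>simp add: cmp_assoc_right\<close>)
qed

text \<open>The joint coequalizer of all pairs into \<open>X\<close>, from a small set of
  representatives of the finitely presentable objects, that \<open>g\<close> identifies. The arrow
  \<open>g'\<close> need not be monic yet, because arrows from finitely presentable objects into
  \<open>Z\<close> need not lift to \<open>X\<close>; hence the later iteration.\<close>

lemma kernel_quotient:
  assumes X: "X \<in> obj A" and Y: "Y \<in> obj A" and g: "g \<in> hom A X Y"
  obtains Z e g' where "Z \<in> obj A" "strong_epi A X Z e" "g' \<in> hom A Z Y" "cmp A X Z Y g' e = g"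
    "\<And>p u v. p \<in> fp \<Longrightarrow> u \<in> hom A p X \<Longrightarrow> v \<in> hom A p X \<Longrightarrow> cmp A p X Y g u = cmp A p X Y g v \<Longrightarrow>
      cmp A p X Z e u = cmp A p X Z e v"
proof -
  obtain S where S: "S \<subseteq> fp" "small TYPE('u) S" "\<And>p. p \<in> fp \<Longrightarrow> \<exists>s\<in>S. isomorphic A p s"
    using lfp unfolding locally_finitely_presentable_def by blast
  define K where "K = {(p, u, v). p \<in> insert X S \<and> u \<in> hom A p X \<and> v \<in> hom A p X \<and>
    cmp A p X Y g u = cmp A p X Y g v}"
  have K_obj: "p \<in> obj A" "u \<in> hom A p X" "v \<in> hom A p X" "cmp A p X Y g u = cmp A p X Y g v"
    if "(p, u, v) \<in> K" for p u v
    using that S(1) X unfolding K_def by auto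
  have K0: "(X, idn A X, idn A X) \<in> K" using X unfolding K_def by simp
  have "small TYPE('u) (insert X S)"
    using small_Un[OF U small_finite[OF U, of "{X}"] S(2)] by simp
  then have "small TYPE('u) (Sigma (insert X S) (\<lambda>p. hom A p X \<times> hom A p X))"
    using ls X S(1) unfolding locally_small_def by (intro small_Sigma[OF U]) auto
  then have sK: "small TYPE('u) K"
    by (rule small_mono[rotated]) (auto simp: K_def)
  \<comment> \<open>Both copies of \<open>X\<close> are identified in the colimit because the pair of identities belongs to \<open>K\<close>.\<close>
  define I where "I = (Inl ` K \<union> range Inr :: ('o \<times> 'u \<times> 'u + bool) set)"
  \<comment> \<open>A poset has at most one arrow between two indices, so the parallel pair
    \<open>u\<close>, \<open>v\<close> is spread over two copies of \<open>X\<close>: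
    \<open>u\<close> goes to the copy \<open>True\<close>, \<open>v\<close> to the copy
    \<open>False\<close>.\<close>
  define r where "r = Id_on I \<union> {(Inl k, Inr b) | k b. k \<in> K}"
  define F where "F = \<lparr>omap = case_sum fst (\<lambda>_. X),
    amap = (\<lambda>i j (_ :: unit). case (i, j) of (Inl (p, u, v), Inr b) \<Rightarrow> if b then u else v
      | _ \<Rightarrow> idn A (case_sum fst (\<lambda>_. X) i))\<rparr>"
  have sI: "small TYPE('u) I"
    unfolding I_def by (intro small_Un[OF U] small_image sK small_finite[OF U]) simp
  have pre: "preorder_on I r"
    unfolding preorder_on_def refl_on_def trans_def r_def I_def by auto
  have F_simps: "omap F (Inl (p, u, v)) = p" "omap F (Inr b) = X"
    "amap F (Inl (p, u, v)) (Inr b) () = (if b then u else v)" for p u v b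
    by (simp_all add: F_def)
  have I_mem: "Inl k \<in> I \<longleftrightarrow> k \<in> K" "Inr b \<in> I" for k b
    unfolding I_def by auto
  have r_mem: "(Inl k, Inr b) \<in> r \<longleftrightarrow> k \<in> K" for k b
    unfolding r_def by blast
  have F_id: "amap F i i () = idn A (omap F i)" for i
    by (cases i) (auto simp: F_def)
  have r_cases: "(i, j) \<in> r \<Longrightarrow>
      i \<in> I \<and> i = j \<or> (\<exists>p u v b. i = Inl (p, u, v) \<and> j = Inr b \<and> (p, u, v) \<in> K)" for i j
    unfolding r_def by auto
  have F_obj: "omap F i \<in> obj A" if "i \<in> I" for i
    using that K_obj(1) X unfolding I_def by (auto simp: F_simps)
  have F_hom: "amap F i j () \<in> hom A (omap F i) (omap F j)" if "(i, j) \<in> r" for i j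
    using r_cases[OF that] K_obj(2,3) F_obj by (auto simp: F_simps F_id)
  have F: "is_functor (poset_cat I r) A F"
    unfolding is_functor_def
  proof (intro conjI ballI)
    fix i j k f g
    assume "f \<in> hom (poset_cat I r) i j" "g \<in> hom (poset_cat I r) j k"
      "i \<in> obj (poset_cat I r)" "j \<in> obj (poset_cat I r)" "k \<in> obj (poset_cat I r)"
    then have ij: "(i, j) \<in> r" and jk: "(j, k) \<in> r" and o: "i \<in> I" "j \<in> I" "k \<in> I" by simp_all
    have "i = j \<or> j = k" using r_cases[OF ij] r_cases[OF jk] by auto
    then show "amap F i k (cmp (poset_cat I r) i j k g f) =
        cmp A (omap F i) (omap F j) (omap F k) (amap F j k g) (amap F i j f)"
      using F_hom[OF ij] F_hom[OF jk] F_obj o by (auto simp: F_id)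
  qed (simp_all add: F_obj F_hom F_id)
  obtain Z t where col: "is_colimit (poset_cat I r) A F Z t"
    using poset_colimit_exists[OF sI pre F] by blast
  note t = is_coconeD[OF is_colimit_cocone[OF col]]
  define e where "e = t (Inr True)"
  have Z: "Z \<in> obj A" using t(1) .
  have leg: "t (Inl (p, u, v)) = cmp A p X Z (t (Inr b)) (if b then u else v)" if "(p, u, v) \<in> K" for p u v b
    using t(3)[of "Inl (p, u, v)" "Inr b" "()"] that by (simp add: I_mem r_mem F_simps)
  have R: "t (Inr b) \<in> hom A X Z" for b
    using t(2)[of "Inr b"] by (simp add: I_mem F_simps)
  have tR: "t (Inr b) = e" for b
    using leg[OF K0, of b] leg[OF K0, of True] R X Z unfolding e_def by (simp split: if_splits)
  have e: "e \<in> hom A X Z" using R unfolding e_def .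
  have legs: "t (Inl (p, u, v)) = cmp A p X Z e u" "cmp A p X Z e u = cmp A p X Z e v"
    if "(p, u, v) \<in> K" for p u v
    using leg[OF that, of True] leg[OF that, of False] tR by simp_all
  \<comment> \<open>Universal property of \<open>e\<close> as a joint coequalizer: an arrow that
    identifies all pairs in \<open>K\<close> factors through \<open>e\<close>.\<close>
  have ex: "\<exists>h\<in>hom A Z W. cmp A X Z W h e = f"
    if W: "W \<in> obj A" and f: "f \<in> hom A X W"
      and co: "\<And>p u v. (p, u, v) \<in> K \<Longrightarrow> cmp A p X W f u = cmp A p X W f v" for W f
  proof -
    define s where "s = case_sum (\<lambda>(p, u, v :: 'u). cmp A p X W f u) (\<lambda>_ :: bool. f)"
    have s_simps: "s (Inl (p, u, v)) = cmp A p X W f u" "s (Inr b) = f" for p u v b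
      by (simp_all add: s_def)
    have "is_cocone (poset_cat I r) A F W s"
      unfolding is_cocone_def
    proof (intro conjI ballI W)
      show s_hom: "s i \<in> hom A (omap F i) W" if "i \<in> obj (poset_cat I r)" for i
        using that K_obj(1-3) X W f unfolding I_def by (auto simp: s_simps F_simps)
      show "cmp A (omap F i) (omap F j) W (s j) (amap F i j a) = s i"
        if i: "i \<in> obj (poset_cat I r)" and "a \<in> hom (poset_cat I r) i j" for i j a
      proof -
        have "(i, j) \<in> r" using that by simp
        then show ?thesis
        proof (rule r_cases[THEN disjE])
          assume "i \<in> I \<and> i = j"
          then show ?thesis using s_hom[OF i] F_obj W by (auto simp: F_id)
        next
          assume "\<exists>p u v b. i = Inl (p, u, v) \<and> j = Inr b \<and> (p, u, v) \<in> K"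
          then obtain p u v b where ij: "i = Inl (p, u, v)" "j = Inr b" "(p, u, v) \<in> K" by blast
          then show ?thesis using co[OF ij(3)] by (simp add: s_simps F_simps)
        qed
      qed
    qed
    then obtain h where h: "h \<in> hom A Z W" "\<And>i. i \<in> I \<Longrightarrow> cmp A (omap F i) Z W h (t i) = s i"
      using is_colimit_ex[OF col] by (metis poset_cat_simps(1))
    then show ?thesis
      using h(2)[OF I_mem(2)] tR by (auto simp: s_simps F_simps)
  qed
  have "h = h'" if W: "W \<in> obj A" and h: "h \<in> hom A Z W" "h' \<in> hom A Z W"
    and eq: "cmp A X Z W h e = cmp A X Z W h' e" for W h h'
  proof (rule colimit_legs_epi[OF col F category_poset_cat[OF pre] h W])
    fix i assume "i \<in> obj (poset_cat I r)"
    then consider p u v where "i = Inl (p, u, v)" "(p, u, v) \<in> K" | b where "i = Inr b"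
      unfolding I_def by auto
    then show "cmp A (omap F i) Z W h (t i) = cmp A (omap F i) Z W h' (t i)"
    proof cases
      case 1
      then show ?thesis using legs(1)[OF 1(2)] K_obj[OF 1(2)] h eq e W X Z
        by (simp add: F_def cmp_assoc)
    next
      case 2
      then show ?thesis using tR eq by (simp add: F_def)
    qed
  qed
  moreover have "\<exists>d\<in>hom A Z w. cmp A X Z w d e = u"
    if w: "w \<in> obj A" "z \<in> obj A" and m: "monic A w z m" and u: "u \<in> hom A X w" and v: "v \<in> hom A Z z"
      and eq: "cmp A X w z m u = cmp A X Z z v e" for w z m u v
  proof (rule ex[OF w(1) u])
    \<comment> \<open>The arrow \<open>u\<close> identifies the pairs in \<open>K\<close> because
      \<open>m\<close> after \<open>u\<close> does, being \<open>v\<close> after \<open>e\<close>,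
      and \<open>m\<close> is monic.\<close>
    fix p a b assume K: "(p, a, b) \<in> K"
    have "cmp A p w z m (cmp A p X w u c) = cmp A p Z z v (cmp A p X Z e c)" if "c \<in> hom A p X" for c
      using K_obj[OF K] eq that u v e w X Z monicD(1)[OF m] by (simp add: cmp_assoc)
    then have "cmp A p w z m (cmp A p X w u a) = cmp A p w z m (cmp A p X w u b)"
      using K_obj[OF K] legs(2)[OF K] by simp
    then show "cmp A p X w u a = cmp A p X w u b"
      by (rule monicD(2)[OF m K_obj(1)[OF K] cmp_hom[OF K_obj(2)[OF K] u K_obj(1)[OF K] X w(1)]
          cmp_hom[OF K_obj(3)[OF K] u K_obj(1)[OF K] X w(1)]])
  qed
  ultimately have se: "strong_epi A X Z e"
    unfolding strong_epi_def using e by blast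
  obtain g' where g': "g' \<in> hom A Z Y" "cmp A X Z Y g' e = g"
    using ex[OF Y g] K_obj(4) by blast
  have "cmp A p X Z e u = cmp A p X Z e v"
    if p: "p \<in> fp" and u: "u \<in> hom A p X" and v: "v \<in> hom A p X"
      and eq: "cmp A p X Y g u = cmp A p X Y g v" for p u v
  proof -
    obtain s a b where s: "s \<in> S" and ab: "a \<in> hom A p s" "b \<in> hom A s p" "cmp A p s p b a = idn A p"
      using S(3)[OF p] unfolding isomorphic_def by blast
    have so: "s \<in> obj A" "p \<in> obj A" using s S(1) p by auto
    \<comment> \<open>The set \<open>K\<close> only contains pairs out of representatives, so the
      pair is precomposed with the isomorphism \<open>b\<close> from \<open>s\<close> to
      \<open>p\<close>; precomposing with \<open>a\<close> returns to \<open>p\<close>.\<close>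
    have "(s, cmp A s p X u b, cmp A s p X v b) \<in> K"
      using s u v ab so X Y g eq unfolding K_def by (simp add: cmp_assoc)
    then have "cmp A s X Z e (cmp A s p X u b) = cmp A s X Z e (cmp A s p X v b)"
      using legs(2) by blast
    then have "cmp A p s Z (cmp A s X Z e (cmp A s p X u b)) a = cmp A p s Z (cmp A s X Z e (cmp A s p X v b)) a"
      by simp
    then show ?thesis using u v ab so X Z e by (simp add: cmp_assoc_right)
  qed
  then show thesis using that[OF Z se g'] by blast
qed

text \<open>Two factorizations are pushed to a common upper bound of their stages.\<close>

lemma hom_commutes_pair:
  assumes hc: "hom_commutes A c I r F z t" and dir: "directed_poset I r"
    and F: "is_functor (poset_cat I r) A F" and t: "is_cocone (poset_cat I r) A F z t"
    and c: "c \<in> obj A" and g: "g \<in> hom A c z" "g' \<in> hom A c z"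
  obtains k f f' where "k \<in> I" "f \<in> hom A c (omap F k)" "f' \<in> hom A c (omap F k)"
    "cmp A c (omap F k) z (t k) f = g" "cmp A c (omap F k) z (t k) f' = g'"
proof -
  note Fd = is_functorD[OF F] and td = is_coconeD[OF t]
  obtain i f where i: "i \<in> I" "f \<in> hom A c (omap F i)" "cmp A c (omap F i) z (t i) f = g"
    using hc g(1) unfolding hom_commutes_def by blast
  obtain j f' where j: "j \<in> I" "f' \<in> hom A c (omap F j)" "cmp A c (omap F j) z (t j) f' = g'"
    using hc g(2) unfolding hom_commutes_def by blast
  obtain k where k: "k \<in> I" "(i, k) \<in> r" "(j, k) \<in> r"
    using directed_posetD(5)[OF dir i(1) j(1)] by blast
  have *: "cmp A c (omap F i) (omap F k) (amap F i k ()) f \<in> hom A c (omap F k) \<and>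
      cmp A c (omap F k) z (t k) (cmp A c (omap F i) (omap F k) (amap F i k ()) f) = g"
    if "i \<in> I" "f \<in> hom A c (omap F i)" "cmp A c (omap F i) z (t i) f = g" "(i, k) \<in> r" for i f g
    using Fd(1)[of i] Fd(1)[of k] Fd(2)[of i k "()"] td(1) td(2)[of k] td(3)[of i k "()"] that k(1) c
    by (simp add: cmp_assoc)
  show thesis
    using that[OF k(1)] *[OF i k(2)] *[OF j k(3)] by blast
qed

text \<open>The mono part arises by iterating \<open>kernel_quotient\<close> countably often: a pair of arrows from a finitely
  presentable object into the colimit lives at some stage and is identified at the next one.\<close>

lemma strong_epi_mono_factorization:
  assumes X: "X \<in> obj A" and Y: "Y \<in> obj A" and g: "g \<in> hom A X Y"
  obtains Q e m where "Q \<in> obj A" "strong_epi A X Q e" "monic A Q Y m" "cmp A X Q Y m e = g"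
proof -
  define step where "step = (\<lambda>(V, f) (W, f') e. strong_epi A V W e \<and> cmp A V W Y f' e = f \<and>
    (\<forall>p\<in>fp. \<forall>u\<in>hom A p V. \<forall>v\<in>hom A p V. cmp A p V Y f u = cmp A p V Y f v \<longrightarrow>
      cmp A p V W e u = cmp A p V W e v))"
  \<comment> \<open>The clause for \<open>n = 0\<close> pins the start of the sequence to
    \<open>(X, g)\<close>, which dependent choice would otherwise leave open.\<close>
  define ok where "ok = (\<lambda>(n :: nat) (V, f). V \<in> obj A \<and> f \<in> hom A V Y \<and> (n = 0 \<longrightarrow> V = X \<and> f = g))"
  have "\<exists>s. \<forall>n. ok n (s n) \<and> (\<exists>e. step (s n) (s (Suc n)) e)"
  proof (rule dependent_nat_choice)
    show "\<exists>a. ok 0 a" unfolding ok_def using X g by (intro exI[of _ "(X, g)"]) simp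
    fix a n assume "ok n a"
    then obtain V f where a: "a = (V, f)" "V \<in> obj A" "f \<in> hom A V Y" unfolding ok_def by auto
    obtain W e f' where "W \<in> obj A" "strong_epi A V W e" "f' \<in> hom A W Y" "cmp A V W Y f' e = f"
      "\<And>p u v. p \<in> fp \<Longrightarrow> u \<in> hom A p V \<Longrightarrow> v \<in> hom A p V \<Longrightarrow> cmp A p V Y f u = cmp A p V Y f v \<Longrightarrow>
        cmp A p V W e u = cmp A p V W e v"
      using kernel_quotient[OF a(2) Y a(3)] by blast
    then have "ok (Suc n) (W, f') \<and> step a (W, f') e" unfolding ok_def step_def a
      by (simp only: prod.case nat.distinct) blast
    then show "\<exists>b. ok (Suc n) b \<and> (\<exists>e. step a b e)" by blast
  qed
  then obtain s where s: "\<And>n. ok n (s n)" "\<And>n. \<exists>e. step (s n) (s (Suc n)) e" by blast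
  obtain es where es: "\<And>n. step (s n) (s (Suc n)) (es n)" using s(2) by metis
  define Xs where "Xs = (\<lambda>n. fst (s n))"
  define gs where "gs = (\<lambda>n. snd (s n))"
  have Xs [simp]: "Xs n \<in> obj A" and gs: "gs n \<in> hom A (Xs n) Y" for n
    using s(1)[of n] unfolding ok_def Xs_def gs_def by (auto simp: case_prod_beta)
  have s0: "Xs 0 = X" "gs 0 = g"
    using s(1)[of 0] unfolding ok_def Xs_def gs_def by (auto simp: case_prod_beta)
  have se: "strong_epi A (Xs n) (Xs (Suc n)) (es n)"
    and gse: "cmp A (Xs n) (Xs (Suc n)) Y (gs (Suc n)) (es n) = gs n"
    and ker: "\<And>p u v. p \<in> fp \<Longrightarrow> u \<in> hom A p (Xs n) \<Longrightarrow> v \<in> hom A p (Xs n) \<Longrightarrow>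
      cmp A p (Xs n) Y (gs n) u = cmp A p (Xs n) Y (gs n) v \<Longrightarrow>
      cmp A p (Xs n) (Xs (Suc n)) (es n) u = cmp A p (Xs n) (Xs (Suc n)) (es n) v" for n
    using es[of n] unfolding step_def Xs_def gs_def case_prod_beta by blast+
  note esh [simp] = strong_epiD(1)[OF se]
  \<comment> \<open>Composite of the steps from \<open>l\<close> to \<open>n\<close>: the recursion
    on \<open>n\<close> restarts with the identity when it reaches \<open>l\<close>. Values for
    \<open>n < l\<close> are meaningless and do not occur as transition arrows.\<close>
  define E where "E = (\<lambda>l. rec_nat (idn A (Xs 0))
    (\<lambda>n f. if l = Suc n then idn A (Xs l) else cmp A (Xs l) (Xs n) (Xs (Suc n)) (es n) f))"
  have E_refl: "E l l = idn A (Xs l)" for l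
    unfolding E_def by (cases l) auto
  have E_Suc: "E l (Suc n) = cmp A (Xs l) (Xs n) (Xs (Suc n)) (es n) (E l n)" if "l \<le> n" for l n
    using that unfolding E_def by simp
  have E_hom [simp]: "E l n \<in> hom A (Xs l) (Xs n)" if "l \<le> n" for l n
    using that by (induction n rule: dec_induct) (simp_all add: E_refl E_Suc)
  have E_cmp: "E l n = cmp A (Xs l) (Xs m) (Xs n) (E m n) (E l m)" if "l \<le> m" "m \<le> n" for l m n
    using that(2)
  proof (induction n rule: dec_induct)
    case base
    then show ?case using that(1) by (simp add: E_refl)
  next
    case (step n)
    then have "l \<le> n" using that(1) by simp
    then show ?case using step that(1) by (simp add: E_Suc cmp_assoc)
  qed
  define r where "r = {(i, j :: nat). i \<le> j}"
  define F where "F = \<lparr>omap = Xs, amap = (\<lambda>i j (_ :: unit). E i j)\<rparr>"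
  have dir: "directed_poset UNIV r"
    unfolding directed_poset_def partial_order_on_def preorder_on_def refl_on_def trans_def antisym_def r_def
    by auto (meson nat_le_linear order_refl)
  then have pre: "preorder_on UNIV r"
    unfolding directed_poset_def partial_order_on_def by blast
  have F: "is_functor (poset_cat UNIV r) A F"
    unfolding is_functor_def F_def r_def by (auto simp: E_refl intro: E_cmp)
  have F_omap: "omap F n = Xs n" for n by (simp add: F_def)
  have "small TYPE('u) (UNIV :: nat set)" using U unfolding universe_def by blast
  then obtain Q t where col: "is_colimit (poset_cat UNIV r) A F Q t"
    and hc: "\<And>p. p \<in> fp \<Longrightarrow> hom_commutes A p UNIV r F Q t"
    using poset_colimit_exists[OF _ pre F] dir by metis
  note cocone = is_colimit_cocone[OF col]
  have Q [simp]: "Q \<in> obj A" using is_coconeD(1)[OF cocone] .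
  have t [simp]: "t n \<in> hom A (Xs n) Q" for n
    using is_coconeD(2)[OF cocone, of n] by (simp add: F_def)
  have tE: "cmp A (Xs l) (Xs n) Q (t n) (E l n) = t l" if "l \<le> n" for l n
    using is_coconeD(3)[OF cocone, of l n "()"] that by (simp add: F_def r_def)
  have te: "cmp A (Xs n) (Xs (Suc n)) Q (t (Suc n)) (es n) = t n" for n
    using tE[of n "Suc n"] by (simp add: E_Suc E_refl)
  have gE: "cmp A (Xs l) (Xs n) Y (gs n) (E l n) = gs l" if "l \<le> n" for l n
    using that
  proof (induction n rule: dec_induct)
    case base
    then show ?case using gs Y by (simp add: E_refl)
  next
    case (step n)
    then show ?case using gs Y gse by (simp add: E_Suc cmp_assoc)
  qed
  have "is_cocone (poset_cat UNIV r) A F Y gs"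
    unfolding is_cocone_def F_def r_def using Y gs gE by simp
  from is_colimit_ex[OF col this] obtain m where m: "m \<in> hom A Q Y"
    and m': "\<And>i. i \<in> obj (poset_cat UNIV r) \<Longrightarrow> cmp A (omap F i) Q Y m (t i) = gs i" by blast
  have mt: "cmp A (Xs n) Q Y m (t n) = gs n" for n
    using m'[of n] by (simp add: F_def)
  have mono: "monic A Q Y m"
  proof (rule monicI_fp[OF m Q Y])
    fix p u v assume p: "p \<in> fp" and u: "u \<in> hom A p Q" and v: "v \<in> hom A p Q"
      and eq: "cmp A p Q Y m u = cmp A p Q Y m v"
    obtain n u' v' where n: "u' \<in> hom A p (Xs n)" "v' \<in> hom A p (Xs n)"
      "cmp A p (Xs n) Q (t n) u' = u" "cmp A p (Xs n) Q (t n) v' = v"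
      using hom_commutes_pair[OF hc[OF p] dir F cocone fp_obj[OF p] u v] unfolding F_omap by blast
    have "cmp A p (Xs n) Y (gs n) w = cmp A p Q Y m (cmp A p (Xs n) Q (t n) w)" if "w \<in> hom A p (Xs n)" for w
      using mt[of n] that p m Y by (simp add: cmp_assoc)
    then have e: "cmp A p (Xs n) (Xs (Suc n)) (es n) u' = cmp A p (Xs n) (Xs (Suc n)) (es n) v'"
      using ker[OF p n(1,2)] n eq by simp
    have "cmp A p (Xs n) Q (t n) w = cmp A p (Xs (Suc n)) Q (t (Suc n)) (cmp A p (Xs n) (Xs (Suc n)) (es n) w)"
      if "w \<in> hom A p (Xs n)" for w
      using te[of n] that p by (simp add: cmp_assoc)
    then show "u = v" using e n by metis
  qed
  \<comment> \<open>Agreement on stage 0 spreads to all stages since every \<open>es n\<close> is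
    epi, and the legs are jointly epic.\<close>
  have epi: "h = h'" if W: "W \<in> obj A" and h: "h \<in> hom A Q W" "h' \<in> hom A Q W"
    and eq: "cmp A (Xs 0) Q W h (t 0) = cmp A (Xs 0) Q W h' (t 0)" for W h h'
  proof (rule colimit_legs_epi[OF col F category_poset_cat[OF pre] h W])
    fix n
    have "cmp A (Xs n) Q W h (t n) = cmp A (Xs n) Q W h' (t n)"
    proof (induction n)
      case (Suc n)
      have "cmp A (Xs n) (Xs (Suc n)) W (cmp A (Xs (Suc n)) Q W k (t (Suc n))) (es n) = cmp A (Xs n) Q W k (t n)"
        if "k \<in> hom A Q W" for k
        using that W te[of n] by (simp add: cmp_assoc_right)
      then show ?case
        using strong_epiD(2)[OF se W cmp_hom[OF t h(1) Xs Q W] cmp_hom[OF t h(2) Xs Q W]] h Suc by metis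
    qed (rule eq)
    then show "cmp A (omap F n) Q W h (t n) = cmp A (omap F n) Q W h' (t n)" by (simp add: F_def)
  qed
  have lift: "\<exists>d\<in>hom A Q w. cmp A (Xs 0) Q w d (t 0) = u"
    if w: "w \<in> obj A" and z: "z \<in> obj A" and k: "monic A w z k" and u: "u \<in> hom A (Xs 0) w"
      and v: "v \<in> hom A Q z" and eq: "cmp A (Xs 0) w z k u = cmp A (Xs 0) Q z v (t 0)" for w z k u v
  proof -
    note kh = monicD(1)[OF k]
    \<comment> \<open>Diagonals are found stage by stage by lifting against \<open>es n\<close>.
      They are then chosen independently for each \<open>n\<close>; as \<open>k\<close> is monic
      each is determined by its composite with \<open>k\<close>, which forces compatibility.\<close>
    have "\<exists>d\<in>hom A (Xs n) w. cmp A (Xs n) w z k d = cmp A (Xs n) Q z v (t n)" for n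
    proof (induction n)
      case 0
      then show ?case using u eq by blast
    next
      case (Suc n)
      then obtain d where d: "d \<in> hom A (Xs n) w" "cmp A (Xs n) w z k d = cmp A (Xs n) Q z v (t n)" by blast
      have "cmp A (Xs n) w z k d = cmp A (Xs n) (Xs (Suc n)) z (cmp A (Xs (Suc n)) Q z v (t (Suc n))) (es n)"
        using d te[of n] v z by (simp add: cmp_assoc_right)
      then show ?case
        using strong_epi_lift[OF se k d(1) cmp_hom[OF t v Xs Q z] _ Xs Xs w z] by metis
    qed
    then obtain d where d: "\<And>n. d n \<in> hom A (Xs n) w"
      and kd: "\<And>n. cmp A (Xs n) w z k (d n) = cmp A (Xs n) Q z v (t n)" by metis
    have dE: "cmp A (Xs l) (Xs n) w (d n) (E l n) = d l" if "l \<le> n" for l n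
    proof (rule monicD(2)[OF k Xs _ d])
      show "cmp A (Xs l) (Xs n) w (d n) (E l n) \<in> hom A (Xs l) w" using d that w by simp
      have "cmp A (Xs l) w z k (cmp A (Xs l) (Xs n) w (d n) (E l n)) =
          cmp A (Xs l) (Xs n) z (cmp A (Xs n) Q z v (t n)) (E l n)"
        using d kh that w z kd[of n] by (simp add: cmp_assoc)
      also have "\<dots> = cmp A (Xs l) Q z v (t l)"
        using v that z tE[OF that] by (simp add: cmp_assoc_right)
      finally show "cmp A (Xs l) w z k (cmp A (Xs l) (Xs n) w (d n) (E l n)) = cmp A (Xs l) w z k (d l)"
        using kd by simp
    qed
    have "is_cocone (poset_cat UNIV r) A F w d"
      unfolding is_cocone_def F_def r_def using w d dE by simp
    from is_colimit_ex[OF col this] obtain h where h: "h \<in> hom A Q w"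
      and h': "\<And>i. i \<in> obj (poset_cat UNIV r) \<Longrightarrow> cmp A (omap F i) Q w h (t i) = d i" by blast
    have "cmp A (Xs 0) Q w h (t 0) = d 0"
      using h'[of 0] by (simp add: F_def)
    moreover have "d 0 = u" by (rule monicD(2)[OF k Xs d u]) (simp add: kd eq)
    ultimately show ?thesis using h by blast
  qed
  have "strong_epi A (Xs 0) Q (t 0)"
    unfolding strong_epi_def using epi lift t by blast
  then show thesis using that[OF Q _ mono] mt[of 0] by (simp add: s0)
qed

section \<open>Strong quotients of finitely presentable objects\<close>

text \<open>The test objects of the counting argument: closed under strong quotients, with finite
  hom-sets into objects of finite type, and finitely generated.\<close>

definition fp_quotient :: "'o \<Rightarrow> bool" where
  "fp_quotient c \<longleftrightarrow> c \<in> obj A \<and> (\<exists>p\<in>fp. \<exists>e. strong_epi A p c e)"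

lemma fp_quotient_obj: "fp_quotient c \<Longrightarrow> c \<in> obj A"
  unfolding fp_quotient_def by blast

lemma fp_quotient_strong_epi:
  assumes "fp_quotient c" "strong_epi A c x e" "x \<in> obj A"
  shows "fp_quotient x"
  using assms strong_epi_cmp[OF _ assms(2)] fp_obj unfolding fp_quotient_def by blast

text \<open>It is enough to test with finitely presentable objects. Arrows identified by a leg are
  already identified at a later stage, and the transition to that stage is monic.\<close>

lemma directed_colimit_monic_legs:
  assumes D: "directed_diagram I r A F" and col: "is_colimit (poset_cat I r) A F z t"
    and mono: "\<And>i j. (i, j) \<in> r \<Longrightarrow> monic A (omap F i) (omap F j) (amap F i j ())"
    and i: "i \<in> I"
  shows "monic A (omap F i) z (t i)"
proof -
  note t = is_coconeD[OF is_colimit_cocone[OF col]] and F = is_functorD[OF directed_diagramD(2)[OF D]]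
  have o: "omap F i \<in> obj A" using F(1) i by simp
  have ti: "t i \<in> hom A (omap F i) z" using t(2) i by simp
  show ?thesis
  proof (rule monicI_fp[OF ti o t(1)])
    fix p u v assume p: "p \<in> fp" and u: "u \<in> hom A p (omap F i)" and v: "v \<in> hom A p (omap F i)"
      and eq: "cmp A p (omap F i) z (t i) u = cmp A p (omap F i) z (t i) v"
    then obtain k where "(i, k) \<in> r"
      "cmp A p (omap F i) (omap F k) (amap F i k ()) u = cmp A p (omap F i) (omap F k) (amap F i k ()) v"
      using fp_hom_commutes[OF p D col] i unfolding hom_commutes_def by blast
    then show "u = v" using monicD(2)[OF mono fp_obj[OF p] u v] by blast
  qed
qed

lemma fp_quotient_fg:
  assumes c: "fp_quotient c"
  shows "c \<in> fg_objects A"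
proof -
  obtain p e where p: "p \<in> fp" and e: "strong_epi A p c e" using c unfolding fp_quotient_def by blast
  note co = fp_quotient_obj[OF c] and eh = strong_epiD(1)[OF e]
  have "is_colimit (poset_cat I r) set_cat (comp_func (hom_func A c) F) (omap (hom_func A c) z)
      (\<lambda>i. amap (hom_func A c) (omap F i) z (t i))"
    if D: "directed_diagram I r A F"
      and mono: "\<forall>(i, j)\<in>r. monic A (omap F i) (omap F j) (amap F i j ())"
      and col: "is_colimit (poset_cat I r) A F z t" for I r F z t
  proof -
    note t = is_coconeD[OF is_colimit_cocone[OF col]] and F = is_functorD[OF directed_diagramD(2)[OF D]]
    have Fo: "omap F i \<in> obj A" if "i \<in> I" for i using F(1) that by simp
    have legs: "monic A (omap F i) z (t i)" if "i \<in> I" for i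
      using directed_colimit_monic_legs[OF D col _ that] mono by blast
    \<comment> \<open>The composite of \<open>g\<close> with \<open>e\<close> factors through a
      stage because \<open>p\<close> is finitely presentable. The leg of that stage is monic, so the
      diagonal property makes \<open>g\<close> itself factor.\<close>
    have surj: "\<exists>i\<in>I. \<exists>f\<in>hom A c (omap F i). cmp A c (omap F i) z (t i) f = g" if g: "g \<in> hom A c z" for g
    proof -
      obtain i f where i: "i \<in> I" "f \<in> hom A p (omap F i)"
        "cmp A p (omap F i) z (t i) f = cmp A p c z g e"
        using fp_hom_commutes[OF p D col] cmp_hom[OF eh g fp_obj[OF p] co t(1)]
        unfolding hom_commutes_def by blast
      then show ?thesis
        using strong_epi_lift[OF e legs[OF i(1)] i(2) g i(3) fp_obj[OF p] co Fo[OF i(1)] t(1)] by blast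
    qed
    have ident: "f = f'" if "i \<in> I" "f \<in> hom A c (omap F i)" "f' \<in> hom A c (omap F i)"
      "cmp A c (omap F i) z (t i) f = cmp A c (omap F i) z (t i) f'" for i f f'
      using monicD(2)[OF legs co] that by blast
    have "hom_commutes A c I r F z t"
      unfolding hom_commutes_def using surj ident directed_posetD(2)[OF directed_diagramD(1)[OF D]] by blast
    then show ?thesis
      using hom_commutes_iff_is_colimit[OF U cat ls co directed_diagramD(1,2)[OF D] is_colimit_cocone[OF col]]
      by blast
  qed
  then show ?thesis
    using co unfolding fg_objects_def preserves_directed_colimits_of_monos_def preserves_colimits_of_def
    by blast
qed

section \<open>Counting arrows by their strong epi part\<close>

lemma inj_on_strong_epi:
  assumes "strong_epi A x y e" "z \<in> obj A"
  shows "inj_on (\<lambda>f. cmp A x y z f e) (hom A y z)"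
  using strong_epiD(2)[OF assms] by (intro inj_onI) blast

lemma finite_hom_fp_quotient:
  assumes c: "fp_quotient c" and a: "a \<in> obj A" and fin: "finite_fp_type A a"
  shows "finite (hom A c a)"
proof -
  obtain p e where p: "p \<in> fp" and e: "strong_epi A p c e" using c unfolding fp_quotient_def by blast
  have "(\<lambda>f. cmp A p c a f e) ` hom A c a \<subseteq> hom A p a"
    using strong_epiD(1)[OF e] fp_quotient_obj[OF c] a p by auto
  moreover have "finite (hom A p a)" using fin p unfolding finite_fp_type_def by blast
  ultimately show ?thesis
    using inj_on_strong_epi[OF e a] by (meson finite_imageD finite_subset)
qed

text \<open>All strong epi parts of \<open>f\<close>, that is, a whole isomorphism class of
  quotients of \<open>c\<close>. Taking the full class avoids choosing representatives and lets
  arrows into different targets be compared by plain equality of sets.\<close>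

definition coimages :: "'o \<Rightarrow> 'o \<Rightarrow> 'u \<Rightarrow> ('o \<times> 'u) set" where
  "coimages c a f = {(x, e). x \<in> obj A \<and> strong_epi A c x e \<and> (\<exists>m. monic A x a m \<and> cmp A c x a m e = f)}"

lemma coimages_nonempty:
  assumes "c \<in> obj A" "a \<in> obj A" "f \<in> hom A c a"
  obtains x e where "(x, e) \<in> coimages c a f"
  using strong_epi_mono_factorization[OF assms] unfolding coimages_def by blast

lemma coimages_subset:
  \<comment> \<open>Together with its mirror image this shows that two classes which meet coincide.
    The diagonal \<open>d\<close> between the two factorizations of \<open>f\<close> is monic since
    \<open>m\<close> after \<open>d\<close> is, so \<open>n\<close> after \<open>d\<close> is a mono
    part for \<open>g\<close>.\<close>
  assumes f: "(x, e) \<in> coimages c a f" and g: "(x, e) \<in> coimages c b g"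
    and o: "c \<in> obj A" "a \<in> obj A" "b \<in> obj A"
  shows "coimages c a f \<subseteq> coimages c b g"
proof (clarify)
  fix y e' assume "(y, e') \<in> coimages c a f"
  then obtain m' where y: "y \<in> obj A" and e': "strong_epi A c y e'" and m': "monic A y a m'"
    and fm': "cmp A c y a m' e' = f" unfolding coimages_def by blast
  obtain m where x: "x \<in> obj A" and e: "strong_epi A c x e" and m: "monic A x a m"
    and fm: "cmp A c x a m e = f" using f unfolding coimages_def by blast
  obtain n where n: "monic A x b n" and gn: "cmp A c x b n e = g" using g unfolding coimages_def by blast
  have "cmp A c x a m e = cmp A c y a m' e'" using fm fm' by simp
  then obtain d where d: "d \<in> hom A y x" "cmp A c y x d e' = e" "cmp A y x a m d = m'"
    using strong_epi_lift[OF e' m strong_epiD(1)[OF e] monicD(1)[OF m'] _ o(1) y x o(2)] by blast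
  have "monic A y x d"
    using monic_cancel[of y a x m d] m' d(1,3) monicD(1)[OF m] x y o by simp
  then have "monic A y b (cmp A y x b n d)" using monic_cmp[OF _ n y x o(3)] by blast
  moreover have "cmp A c y b (cmp A y x b n d) e' = g"
    using gn d strong_epiD(1)[OF e'] monicD(1)[OF n] x y o by (simp add: cmp_assoc_right)
  ultimately show "(y, e') \<in> coimages c b g"
    unfolding coimages_def using y e' by blast
qed

lemma idn_in_coimages_iff:
  assumes "c \<in> obj A" "a \<in> obj A"
  shows "(c, idn A c) \<in> coimages c a f \<longleftrightarrow> monic A c a f"
proof -
  have "cmp A c c a m (idn A c) = m" if "monic A c a m" for m
    using cmp_idn(1)[OF monicD(1)[OF that] assms] .
  then show ?thesis
    using assms strong_epi_idn[of c] unfolding coimages_def by fastforce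
qed

definition monics :: "'o \<Rightarrow> 'o \<Rightarrow> 'u set" where
  "monics x y = {m. monic A x y m}"

text \<open>By the previous inclusions, \<open>f\<close> lies in the class of \<open>(x, e)\<close>
  exactly when it is a mono after \<open>e\<close>, and the mono is unique as \<open>e\<close> is
  epi. The class may come from another target \<open>b\<close>, so the same class can be counted in
  two targets.\<close>

lemma card_coimages_class:
  assumes x: "(x, e) \<in> coimages c b g" and o: "c \<in> obj A" "a \<in> obj A" "b \<in> obj A"
  shows "card {f \<in> hom A c a. coimages c a f = coimages c b g} = card (monics x a)"
proof -
  have xo: "x \<in> obj A" and e: "strong_epi A c x e" using x unfolding coimages_def by blast+
  have "bij_betw (\<lambda>m. cmp A c x a m e) (monics x a) {f \<in> hom A c a. coimages c a f = coimages c b g}"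
    unfolding bij_betw_def
  proof (intro conjI equalityI subsetI)
    show "inj_on (\<lambda>m. cmp A c x a m e) (monics x a)"
      using inj_on_strong_epi[OF e o(2)] by (rule inj_on_subset) (auto simp: monics_def dest: monicD(1))
  next
    fix f assume "f \<in> (\<lambda>m. cmp A c x a m e) ` monics x a"
    then obtain m where m: "monic A x a m" "f = cmp A c x a m e" unfolding monics_def by blast
    then have "(x, e) \<in> coimages c a f" unfolding coimages_def using xo e by blast
    then have "coimages c a f = coimages c b g"
      using coimages_subset[of x e c a f b g] coimages_subset[of x e c b g a f] x o by blast
    moreover have "f \<in> hom A c a"
      unfolding m(2) using cmp_hom[OF strong_epiD(1)[OF e] monicD(1)[OF m(1)] o(1) xo o(2)] .
    ultimately show "f \<in> {f \<in> hom A c a. coimages c a f = coimages c b g}" by blast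
  next
    fix f assume "f \<in> {f \<in> hom A c a. coimages c a f = coimages c b g}"
    then have "(x, e) \<in> coimages c a f" using x by simp
    then show "f \<in> (\<lambda>m. cmp A c x a m e) ` monics x a"
      unfolding coimages_def monics_def by blast
  qed
  then show ?thesis by (simp add: bij_betw_same_card)
qed

text \<open>Precomposition with \<open>e\<close> is injective. A mono \<open>m\<close> is not in its
  image unless \<open>e\<close> is monic, since a factor applied first in a mono is monic; this
  gives the strict decrease.\<close>

lemma card_hom_strong_epi_less:
  assumes e: "strong_epi A c x e" and o: "c \<in> obj A" "x \<in> obj A" "a \<in> obj A" and fin: "finite (hom A c a)"
  shows "card (hom A x a) \<le> card (hom A c a)"
    and "monic A c a m \<Longrightarrow> \<not> monic A c x e \<Longrightarrow> card (hom A x a) < card (hom A c a)"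
proof -
  let ?E = "\<lambda>h. cmp A c x a h e"
  have sub: "?E ` hom A x a \<subseteq> hom A c a"
    using strong_epiD(1)[OF e] o by auto
  have card: "card (?E ` hom A x a) = card (hom A x a)"
    by (rule card_image[OF inj_on_strong_epi[OF e o(3)]])
  show "card (hom A x a) \<le> card (hom A c a)"
    using card_mono[OF fin sub] card by simp
  assume m: "monic A c a m" and ne: "\<not> monic A c x e"
  have "m \<notin> ?E ` hom A x a"
    using monic_cancel[OF _ strong_epiD(1)[OF e] _ o] m ne by blast
  then have "?E ` hom A x a \<subset> hom A c a"
    using sub monicD(1)[OF m] by blast
  then show "card (hom A x a) < card (hom A c a)"
    using psubset_card_mono[OF fin, of "?E ` hom A x a"] card by simp
qed

lemma card_monics_eq:
  assumes o: "a \<in> obj A" "b \<in> obj A" and fin: "finite_fp_type A a" "finite_fp_type A b"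
    and eq: "\<And>c. fp_quotient c \<Longrightarrow> card (hom A c a) = card (hom A c b)"
    and c: "fp_quotient c"
  shows "card (monics c a) = card (monics c b)"
  using c
proof (induction "card (hom A c a) + card (hom A c b)" arbitrary: c rule: less_induct)
  case less
  note co = fp_quotient_obj[OF less.prems]
  have fin_a: "finite (hom A c a)" and fin_b: "finite (hom A c b)"
    using finite_hom_fp_quotient[OF less.prems] o fin by blast+
  show ?case
  proof (cases "monics c a = {} \<and> monics c b = {}")
    case False
    then obtain y m where y: "y \<in> {a, b}" and m: "monic A c y m" unfolding monics_def by blast
    \<comment> \<open>The class of the identity quotient, whose members are exactly the monos out of
      \<open>c\<close>. It is the one class that the induction hypothesis does not cover.\<close>
    define K0 where "K0 = coimages c y m"
    define N where "N = (\<lambda>z K. card {f \<in> hom A c z. coimages c z f = K})"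
    \<comment> \<open>Classes from both targets are collected, so that both hom-counts are sums over
      the same index set.\<close>
    define T where "T = coimages c a ` hom A c a \<union> coimages c b ` hom A c b"
    have yo: "y \<in> obj A" using y o by blast
    have idK0: "(c, idn A c) \<in> K0" unfolding K0_def idn_in_coimages_iff[OF co yo] by (rule m)
    have finT: "finite T" unfolding T_def using fin_a fin_b by blast
    have K0T: "K0 \<in> T" unfolding T_def K0_def using y monicD(1)[OF m] by blast
    have sum: "card (hom A c z) = N z K0 + (\<Sum>K\<in>T - {K0}. N z K)" if z: "z \<in> {a, b}" for z
    proof -
      have "finite (hom A c z)" using z fin_a fin_b by blast
      moreover have "coimages c z ` hom A c z \<subseteq> T" using z unfolding T_def by blast
      ultimately have "(\<Sum>K\<in>T. N z K) = card (hom A c z)"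
        using sum.group[OF _ finT, of "hom A c z" "coimages c z" "\<lambda>_. 1 :: nat"]
        unfolding N_def by simp
      then show ?thesis using sum.remove[OF finT K0T, of "N z"] by simp
    qed
    have "N a K = N b K" if K: "K \<in> T - {K0}" for K
    proof -
      obtain z f where z: "z \<in> {a, b}" and f: "f \<in> hom A c z" and Kf: "K = coimages c z f"
        using K unfolding T_def by blast
      have zo: "z \<in> obj A" using z o by blast
      obtain x e where xe: "(x, e) \<in> coimages c z f" using coimages_nonempty[OF co zo f] by blast
      then obtain n where x: "x \<in> obj A" and e: "strong_epi A c x e" and n: "monic A x z n"
        and fn: "cmp A c x z n e = f" unfolding coimages_def by blast
      have "\<not> monic A c x e"
      proof
        assume "monic A c x e"
        then have "monic A c z f" using monic_cmp[OF _ n co x zo] fn by blast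
        then have "(c, idn A c) \<in> coimages c z f" using idn_in_coimages_iff[OF co zo] by blast
        then have "coimages c z f = K0"
          using coimages_subset[of c "idn A c" c z f y m] coimages_subset[of c "idn A c" c y m z f]
            idK0 co zo yo unfolding K0_def by blast
        then show False using K Kf by blast
      qed
      \<comment> \<open>The mono \<open>m\<close> makes the count into \<open>y\<close> drop
        strictly; the other count does not grow. So the sum of the two is a measure that works
        whichever target receives the mono.\<close>
      then have "card (hom A x y) < card (hom A c y)"
        using card_hom_strong_epi_less(2)[OF e co x yo _ m] y fin_a fin_b by blast
      moreover have "card (hom A x a) \<le> card (hom A c a)" "card (hom A x b) \<le> card (hom A c b)"
        using card_hom_strong_epi_less(1)[OF e co x] o fin_a fin_b by blast+
      ultimately have "card (hom A x a) + card (hom A x b) < card (hom A c a) + card (hom A c b)"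
        using y by auto
      then have "card (monics x a) = card (monics x b)"
        using less.hyps[OF _ fp_quotient_strong_epi[OF less.prems e x]] by blast
      then show ?thesis
        unfolding N_def Kf using card_coimages_class[OF xe co _ zo] o by simp
    qed
    then have "N a K0 = N b K0"
      using sum[of a] sum[of b] eq[OF less.prems] by simp
    then show ?thesis
      using card_coimages_class[OF idK0[unfolded K0_def] co _ yo] o unfolding N_def K0_def by simp
  qed simp
qed

section \<open>Reconstruction from hom-counts\<close>

lemma fp_injective_arrow:
  assumes a: "a \<in> obj A" and b: "b \<in> obj A" and fin: "finite_fp_type A b"
    and emb: "\<And>c. fp_quotient c \<Longrightarrow> monics c a \<noteq> {} \<Longrightarrow> monics c b \<noteq> {}"
  obtains h where "h \<in> hom A a b"
    "\<And>p. p \<in> fp \<Longrightarrow> inj_on (\<lambda>u. cmp A p a b h u) (hom A p a)"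
proof -
  obtain I r F t where D: "directed_diagram I r A F" and p: "\<And>i. i \<in> I \<Longrightarrow> omap F i \<in> fp"
    and col: "is_colimit (poset_cat I r) A F a t" using fp_presentation[OF a] by blast
  note dir = directed_diagramD(1)[OF D] and Fun = directed_diagramD(2)[OF D]
  note cocone = is_colimit_cocone[OF col]
  have sub: "i \<in> I" "j \<in> I" if "(i, j) \<in> r" for i j
    using directed_posetD(1)[OF dir] that by blast+
  have Fo: "omap F i \<in> obj A" if "i \<in> I" for i using fp_obj[OF p[OF that]] .
  have t: "t i \<in> hom A (omap F i) a" if "i \<in> I" for i
    using is_coconeD(2)[OF cocone] that by simp
  have Fh: "amap F i j () \<in> hom A (omap F i) (omap F j)" if "(i, j) \<in> r" for i j
    using is_functorD(2)[OF Fun] sub[OF that] that by simp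
  have tF: "cmp A (omap F i) (omap F j) a (t j) (amap F i j ()) = t i" if "(i, j) \<in> r" for i j
    using is_coconeD(3)[OF cocone] sub[OF that] that by simp
  have Fcmp: "amap F i k () = cmp A (omap F i) (omap F j) (omap F k) (amap F j k ()) (amap F i j ())"
    if "(i, j) \<in> r" "(j, k) \<in> r" for i j k
    using is_functorD(4)[OF Fun, of i j k "()" "()"] that sub[OF that(1)] sub[OF that(2)] by simp
  have "\<forall>i\<in>I. \<exists>q e m. q \<in> obj A \<and> strong_epi A (omap F i) q e \<and> monic A q a m \<and>
      cmp A (omap F i) q a m e = t i"
    using strong_epi_mono_factorization[OF Fo a t] by metis
  then obtain q e m where q: "\<And>i. i \<in> I \<Longrightarrow> q i \<in> obj A"
    and e: "\<And>i. i \<in> I \<Longrightarrow> strong_epi A (omap F i) (q i) (e i)"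
    and m: "\<And>i. i \<in> I \<Longrightarrow> monic A (q i) a (m i)"
    and me: "\<And>i. i \<in> I \<Longrightarrow> cmp A (omap F i) (q i) a (m i) (e i) = t i" by metis
  note eh = strong_epiD(1)[OF e]
  \<comment> \<open>The composites of the monos with \<open>e i\<close> are stored instead of the
    monos. Restriction is then precomposition with a transition arrow, and a compatible family is
    literally a cocone on the presentation of \<open>a\<close>.\<close>
  define N where "N = (\<lambda>i. (\<lambda>n. cmp A (omap F i) (q i) b n (e i)) ` monics (q i) b)"
  define \<rho> where "\<rho> = (\<lambda>i j g. cmp A (omap F i) (omap F j) b g (amap F i j ()))"
  have fq: "fp_quotient (q i)" if "i \<in> I" for i
    unfolding fp_quotient_def using q e p that by blast
  have N_hom: "N i \<subseteq> hom A (omap F i) b" if "i \<in> I" for i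
    unfolding N_def monics_def using cmp_hom[OF eh monicD(1) Fo q b] that by blast
  have "\<exists>x\<in>Pi\<^sub>E I N. \<forall>(i, j)\<in>r. x i = \<rho> i j (x j)"
  proof (rule finite_inverse_limit[OF dir])
    fix i assume i: "i \<in> I"
    show "finite (N i)"
      using finite_subset[OF N_hom[OF i]] fin p[OF i] unfolding finite_fp_type_def by blast
    have "monics (q i) a \<noteq> {}" using m[OF i] unfolding monics_def by blast
    then show "N i \<noteq> {}" using emb[OF fq[OF i]] unfolding N_def by blast
  next
    fix i j y assume ij: "(i, j) \<in> r" and y: "y \<in> N j"
    note i = sub(1)[OF ij] and j = sub(2)[OF ij]
    obtain n where n: "monic A (q j) b n" and yn: "y = cmp A (omap F j) (q j) b n (e j)"
      using y unfolding N_def monics_def by blast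
    have ejF: "cmp A (omap F i) (omap F j) (q j) (e j) (amap F i j ()) \<in> hom A (omap F i) (q j)"
      using cmp_hom[OF Fh[OF ij] eh[OF j] Fo[OF i] Fo[OF j] q[OF j]] .
    have "cmp A (omap F i) (q j) a (m j) (cmp A (omap F i) (omap F j) (q j) (e j) (amap F i j ())) =
        cmp A (omap F i) (q i) a (m i) (e i)"
      using cmp_assoc[OF Fh[OF ij] eh[OF j] monicD(1)[OF m[OF j]] Fo[OF i] Fo[OF j] q[OF j] a]
        me[OF i] me[OF j] tF[OF ij] by simp
    then obtain d where d: "d \<in> hom A (q i) (q j)"
      "cmp A (omap F i) (q i) (q j) d (e i) = cmp A (omap F i) (omap F j) (q j) (e j) (amap F i j ())"
      "cmp A (q i) (q j) a (m j) d = m i"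
      using strong_epi_lift[OF e[OF i] m[OF j] ejF monicD(1)[OF m[OF i]] _ Fo[OF i] q[OF i] q[OF j] a]
      by blast
    \<comment> \<open>The images form a diagram of subobjects of \<open>a\<close>: the induced
      \<open>d\<close> is monic because \<open>m j\<close> after \<open>d\<close> is
      \<open>m i\<close>. Hence a mono out of \<open>q j\<close> restricts to a mono out of
      \<open>q i\<close>.\<close>
    have "monic A (q i) (q j) d"
      using monic_cancel[OF _ d(1) monicD(1)[OF m[OF j]] q[OF i] q[OF j] a] d(3) m[OF i] by simp
    then have "monic A (q i) b (cmp A (q i) (q j) b n d)"
      using monic_cmp[OF _ n q[OF i] q[OF j] b] by blast
    moreover have "\<rho> i j y = cmp A (omap F i) (q i) b (cmp A (q i) (q j) b n d) (e i)"
      unfolding \<rho>_def yn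
      using cmp_assoc[OF Fh[OF ij] eh[OF j] monicD(1)[OF n] Fo[OF i] Fo[OF j] q[OF j] b]
        cmp_assoc[OF eh[OF i] d(1) monicD(1)[OF n] Fo[OF i] q[OF i] q[OF j] b] d(2) by simp
    ultimately show "\<rho> i j y \<in> N i" unfolding N_def monics_def by blast
  next
    fix i j k y assume ij: "(i, j) \<in> r" and jk: "(j, k) \<in> r" and y: "y \<in> N k"
    have "y \<in> hom A (omap F k) b" using N_hom sub(2)[OF jk] y by blast
    then show "\<rho> i k y = \<rho> i j (\<rho> j k y)"
      unfolding \<rho>_def Fcmp[OF ij jk]
      using cmp_assoc[OF Fh[OF ij] Fh[OF jk] _ Fo Fo Fo b] sub[OF ij] sub[OF jk] by blast
  qed
  then obtain x where "x \<in> Pi\<^sub>E I N" and x': "\<forall>(i, j)\<in>r. x i = \<rho> i j (x j)" by blast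
  then have x: "x i \<in> N i" if "i \<in> I" for i using PiE_mem that by metis
  have x\<rho>: "x i = \<rho> i j (x j)" if "(i, j) \<in> r" for i j using x' that by blast
  have "is_cocone (poset_cat I r) A F b x"
    unfolding is_cocone_def
  proof (intro conjI ballI b)
    show "x i \<in> hom A (omap F i) b" if "i \<in> obj (poset_cat I r)" for i
      using N_hom x that by auto
    show "cmp A (omap F i) (omap F j) b (x j) (amap F i j u) = x i"
      if "u \<in> hom (poset_cat I r) i j" for i j u
      using x\<rho>[of i j] that unfolding \<rho>_def by simp
  qed
  from is_colimit_ex[OF col this] obtain h where h: "h \<in> hom A a b"
    and h': "\<And>i. i \<in> obj (poset_cat I r) \<Longrightarrow> cmp A (omap F i) a b h (t i) = x i" by blast
  have "inj_on (\<lambda>u. cmp A p a b h u) (hom A p a)" if p: "p \<in> fp" for p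
  proof (rule inj_onI)
    fix u v assume u: "u \<in> hom A p a" and v: "v \<in> hom A p a" and eq: "cmp A p a b h u = cmp A p a b h v"
    note po = fp_obj[OF p]
    obtain i u' v' where i: "i \<in> I" and u': "u' \<in> hom A p (omap F i)" and v': "v' \<in> hom A p (omap F i)"
      and uu: "cmp A p (omap F i) a (t i) u' = u" and vv: "cmp A p (omap F i) a (t i) v' = v"
      using hom_commutes_pair[OF fp_hom_commutes[OF p D col] dir Fun cocone po u v] by blast
    obtain n where n: "monic A (q i) b n" and xn: "x i = cmp A (omap F i) (q i) b n (e i)"
      using x[OF i] unfolding N_def monics_def by blast
    have hn: "cmp A p (q i) b n (cmp A p (omap F i) (q i) (e i) w) = cmp A p a b h (cmp A p (omap F i) a (t i) w)"
      if w: "w \<in> hom A p (omap F i)" for w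
      using cmp_assoc[OF w eh[OF i] monicD(1)[OF n] po Fo[OF i] q[OF i] b]
        cmp_assoc[OF w t[OF i] h po Fo[OF i] a b] h'[of i] xn i by simp
    \<comment> \<open>On stage \<open>i\<close> the arrow \<open>h\<close> acts as the mono
      \<open>n\<close> after \<open>e i\<close>. Equality after \<open>h\<close> thus already holds
      after \<open>e i\<close>, and \<open>m i\<close> carries it to \<open>a\<close>.\<close>
    have "cmp A p (omap F i) (q i) (e i) u' = cmp A p (omap F i) (q i) (e i) v'"
      by (rule monicD(2)[OF n po cmp_hom[OF u' eh[OF i] po Fo[OF i] q[OF i]]
            cmp_hom[OF v' eh[OF i] po Fo[OF i] q[OF i]]])
        (simp add: hn[OF u'] hn[OF v'] uu vv eq)
    then have "cmp A p (omap F i) a (t i) u' = cmp A p (omap F i) a (t i) v'"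
      using cmp_assoc[OF u' eh[OF i] monicD(1)[OF m[OF i]] po Fo[OF i] q[OF i] a]
        cmp_assoc[OF v' eh[OF i] monicD(1)[OF m[OF i]] po Fo[OF i] q[OF i] a] me[OF i] by simp
    then show "u = v" using uu vv by simp
  qed
  then show thesis using that[OF h] by blast
qed

text \<open>The preimages under \<open>h\<close> of the legs of a presentation of \<open>b\<close>
  assemble to an arrow \<open>g\<close> from \<open>b\<close> to \<open>a\<close>. It is a right
  inverse of \<open>h\<close> by checking on legs, and a left inverse because \<open>h\<close> can
  be cancelled on arrows from finitely presentable objects.\<close>

lemma isomorphic_if_fp_bijective:
  assumes a: "a \<in> obj A" and b: "b \<in> obj A" and h: "h \<in> hom A a b"
    and bij: "\<And>p. p \<in> fp \<Longrightarrow> bij_betw (\<lambda>u. cmp A p a b h u) (hom A p a) (hom A p b)"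
  shows "isomorphic A a b"
proof -
  have inj: "u = v" if "p \<in> fp" "u \<in> hom A p a" "v \<in> hom A p a" "cmp A p a b h u = cmp A p a b h v" for p u v
    using bij[OF that(1)] that(2-4) unfolding bij_betw_def by (auto dest: inj_onD)
  obtain I r F s where D: "directed_diagram I r A F" and p: "\<And>i. i \<in> I \<Longrightarrow> omap F i \<in> fp"
    and col: "is_colimit (poset_cat I r) A F b s" using fp_presentation[OF b] by blast
  note Fun = directed_diagramD(2)[OF D] and cocone = is_colimit_cocone[OF col]
  have Fo: "omap F i \<in> obj A" if "i \<in> I" for i using fp_obj[OF p[OF that]] .
  have s: "s i \<in> hom A (omap F i) b" if "i \<in> I" for i
    using is_coconeD(2)[OF cocone] that by simp
  have "\<forall>i\<in>I. \<exists>k\<in>hom A (omap F i) a. cmp A (omap F i) a b h k = s i"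
  proof
    fix i assume i: "i \<in> I"
    have "s i \<in> (\<lambda>u. cmp A (omap F i) a b h u) ` hom A (omap F i) a"
      using bij_betw_imp_surj_on[OF bij[OF p[OF i]]] s[OF i] by simp
    then show "\<exists>k\<in>hom A (omap F i) a. cmp A (omap F i) a b h k = s i" by (metis imageE)
  qed
  then obtain k where k: "\<And>i. i \<in> I \<Longrightarrow> k i \<in> hom A (omap F i) a"
    and hk: "\<And>i. i \<in> I \<Longrightarrow> cmp A (omap F i) a b h (k i) = s i" by metis
  have "is_cocone (poset_cat I r) A F a k"
    unfolding is_cocone_def
  proof (intro conjI ballI a)
    show "k i \<in> hom A (omap F i) a" if "i \<in> obj (poset_cat I r)" for i using k that by simp
    fix i j u assume i: "i \<in> obj (poset_cat I r)" and j: "j \<in> obj (poset_cat I r)"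
      and u: "u \<in> hom (poset_cat I r) i j"
    have i': "i \<in> I" and j': "j \<in> I" using i j by simp_all
    have Fu: "amap F i j u \<in> hom A (omap F i) (omap F j)" using is_functorD(2)[OF Fun i j u] .
    show "cmp A (omap F i) (omap F j) a (k j) (amap F i j u) = k i"
    proof (rule inj[OF p[OF i'] cmp_hom[OF Fu k[OF j'] Fo[OF i'] Fo[OF j'] a] k[OF i']])
      show "cmp A (omap F i) a b h (cmp A (omap F i) (omap F j) a (k j) (amap F i j u)) =
          cmp A (omap F i) a b h (k i)"
        using cmp_assoc[OF Fu k[OF j'] h Fo[OF i'] Fo[OF j'] a b] hk[OF i'] hk[OF j']
          is_coconeD(3)[OF cocone i j u] by simp
    qed
  qed
  from is_colimit_ex[OF col this] obtain g where g: "g \<in> hom A b a"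
    and gs: "\<And>i. i \<in> obj (poset_cat I r) \<Longrightarrow> cmp A (omap F i) b a g (s i) = k i" by blast
  have hg_hom: "cmp A b a b h g \<in> hom A b b" and gh_hom: "cmp A a b a g h \<in> hom A a a"
    using g h a b by simp_all
  have hg: "cmp A b a b h g = idn A b"
  proof (rule colimit_legs_epi[OF col Fun category_poset_cat[OF directed_diagramD(3)[OF D]] hg_hom idn_hom[OF b] b])
    fix i assume i: "i \<in> obj (poset_cat I r)"
    then have i': "i \<in> I" by simp
    show "cmp A (omap F i) b b (cmp A b a b h g) (s i) = cmp A (omap F i) b b (idn A b) (s i)"
      using cmp_assoc[OF s[OF i'] g h Fo[OF i'] b a b] gs[OF i] hk[OF i'] cmp_idn(2)[OF s[OF i'] Fo[OF i'] b]
      by simp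
  qed
  have "cmp A a b a g h = idn A a"
  proof (rule fp_separates[OF a a gh_hom idn_hom[OF a]])
    fix p u assume p: "p \<in> fp" and u: "u \<in> hom A p a"
    note po = fp_obj[OF p]
    show "cmp A p a a (cmp A a b a g h) u = cmp A p a a (idn A a) u"
    proof (rule inj[OF p cmp_hom[OF u gh_hom po a a] cmp_hom[OF u idn_hom[OF a] po a a]])
      show "cmp A p a b h (cmp A p a a (cmp A a b a g h) u) = cmp A p a b h (cmp A p a a (idn A a) u)"
        using cmp_assoc[OF u gh_hom h po a a b] cmp_assoc[OF h g h a b a b] hg
          cmp_idn(2)[OF h a b] cmp_idn(2)[OF u po a] by simp
    qed
  qed
  then show ?thesis unfolding isomorphic_def using h g hg by blast
qed

lemma bij_betw_hom_if_isomorphic: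
  assumes iso: "isomorphic A a b" and o: "a \<in> obj A" "b \<in> obj A" and c: "c \<in> obj A"
  shows "\<exists>h. bij_betw h (hom A c a) (hom A c b)"
proof -
  obtain f g where f: "f \<in> hom A a b" and g: "g \<in> hom A b a"
    and gf: "cmp A a b a g f = idn A a" and fg: "cmp A b a b f g = idn A b"
    using iso unfolding isomorphic_def by blast
  have "bij_betw (\<lambda>u. cmp A c a b f u) (hom A c a) (hom A c b)"
  proof (rule bij_betw_byWitness[where f' = "\<lambda>u. cmp A c b a g u"])
    show "\<forall>u\<in>hom A c a. cmp A c b a g (cmp A c a b f u) = u"
      using f g o c by (simp add: cmp_assoc gf)
    show "\<forall>u\<in>hom A c b. cmp A c a b f (cmp A c b a g u) = u"
      using f g o c by (simp add: cmp_assoc fg)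
  qed (use f g o c in auto)
  then show ?thesis by blast
qed

lemma isomorphic_if_card_hom_eq:
  assumes o: "a \<in> obj A" "b \<in> obj A" and fin: "finite_fp_type A a" "finite_fp_type A b"
    and eq: "\<And>c. fp_quotient c \<Longrightarrow> card (hom A c a) = card (hom A c b)"
  shows "isomorphic A a b"
proof -
  have fin_monics: "finite (monics c x)" if "fp_quotient c" "x \<in> {a, b}" for c x
  proof (rule finite_subset)
    show "monics c x \<subseteq> hom A c x" unfolding monics_def by (auto dest: monicD(1))
    show "finite (hom A c x)" using finite_hom_fp_quotient[OF that(1)] that(2) o fin by blast
  qed
  \<comment> \<open>Since \<open>card\<close> is 0 on infinite sets as well, finiteness is used to
    read emptiness off the counts.\<close>
  have ne: "monics c a = {} \<longleftrightarrow> monics c b = {}" if c: "fp_quotient c" for c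
    using card_monics_eq[OF o fin eq c] fin_monics[OF c, of a] fin_monics[OF c, of b]
    by (metis card_eq_0_iff insertCI)
  obtain h where h: "h \<in> hom A a b" and h_inj: "\<And>p. p \<in> fp \<Longrightarrow> inj_on (\<lambda>u. cmp A p a b h u) (hom A p a)"
    using fp_injective_arrow[OF o fin(2)] ne by blast
  obtain k where k: "k \<in> hom A b a" and k_inj: "\<And>p. p \<in> fp \<Longrightarrow> inj_on (\<lambda>u. cmp A p b a k u) (hom A p b)"
    using fp_injective_arrow[OF o(2,1) fin(1)] ne by blast
  show ?thesis
  proof (rule isomorphic_if_fp_bijective[OF o h])
    fix p assume p: "p \<in> fp"
    have finp: "finite (hom A p a)" "finite (hom A p b)" using fin p unfolding finite_fp_type_def by blast+
    have hsub: "(\<lambda>u. cmp A p a b h u) ` hom A p a \<subseteq> hom A p b"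
      and ksub: "(\<lambda>u. cmp A p b a k u) ` hom A p b \<subseteq> hom A p a"
      using h k o p by auto
    \<comment> \<open>The injections induced by \<open>h\<close> and \<open>k\<close> bound the two
      finite cardinalities by each other, so the injection induced by \<open>h\<close> is
      onto.\<close>
    have "card ((\<lambda>u. cmp A p a b h u) ` hom A p a) = card (hom A p b)"
      using card_image[OF h_inj[OF p]] card_inj_on_le[OF h_inj[OF p] hsub finp(2)]
        card_inj_on_le[OF k_inj[OF p] ksub finp(1)] by simp
    then show "bij_betw (\<lambda>u. cmp A p a b h u) (hom A p a) (hom A p b)"
      unfolding bij_betw_def using h_inj[OF p] card_subset_eq[OF finp(2) hsub] by blast
  qed
qed

end

theorem theorem5p12:
  fixes A :: "('o, 'u) cat" and a b :: 'o
  assumes "universe TYPE('u)"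
    and "locally_finitely_presentable A"
    and "a \<in> obj A" and "finite_fp_type A a"
    and "b \<in> obj A" and "finite_fp_type A b"
  shows "isomorphic A a b \<longleftrightarrow> (\<forall>c\<in>fg_objects A. \<exists>h. bij_betw h (hom A c a) (hom A c b))"
proof -
  interpret lfp_cat A using assms(1,2) by unfold_locales
  show ?thesis
  proof
    assume "isomorphic A a b"
    then show "\<forall>c\<in>fg_objects A. \<exists>h. bij_betw h (hom A c a) (hom A c b)"
      using bij_betw_hom_if_isomorphic assms(3,5) unfolding fg_objects_def by blast
  next
    assume "\<forall>c\<in>fg_objects A. \<exists>h. bij_betw h (hom A c a) (hom A c b)"
    then have "card (hom A c a) = card (hom A c b)" if "fp_quotient c" for c
      using fp_quotient_fg[OF that] bij_betw_same_card by blast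
    then show "isomorphic A a b"
      using isomorphic_if_card_hom_eq[OF assms(3,5,4,6)] by blast
  qed
qed

end
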